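(* Let $(G,u,v)$ be a connected graph with two non-adjacent 2-valent root-vertices $u$ and $v$, and let $\overline{*}_{uv}(G,u,v)$ be the graph obtained from $G$ by self-bar-amalgamation, i.e. by adding a new edge joining $u$ and $v$. Let $V_G$ be the pgd-vector of $(G,u,v)$. Then the genus polynomial of $\overline{*}_{uv}(G,u,v)$ equals the dot product of $V_G$ with the row-vector $$B=\begin{pmatrix}4x & 1+3x & 2+2x & 4x & 2+2x & 4x & 2+2x & 4x & 4 & 4\end{pmatrix}.$$ That is, $\Gamma_{\overline{*}_{uv}(G,u,v)}(x)=V_G\cdot B$.
   Context: Graphs are finite and connected, and multiple edges are allowed. Embeddings are cellular embeddings in closed orientable surfaces. For a graph $G$, $g_i(G)$ denotes the number of combinatorially distinct embeddings of $G$ in the orientable surface $S_i$ of genus $i$; embeddings are counted as rotation systems of $G$ (an assignment to each vertex of a cyclic ordering of the edge-ends at that vertex). The genus distribution of $G$ is the sequence $(g_i(G))_{i\ge0}$, encoded by the genus polynomial $\Gamma_G(x)=\sum_{i\ge 0} g_i(G)x^i$. Let $(G,u,v)$ be a graph with two distinct 2-valent root-vertices. An fb-walk is a face-boundary walk of an embedding. At a 2-valent root, the two face-corners lie either on two distinct fb-walks (type $d$) or on one fb-walk that is twice incident on the root (type $s$). An embedding has type $dd,ds,sd,ss$ according to the type at $u$ (first letter) and at $v$ (second letter). For each $i\ge 0$ these are sub-partitioned as follows, each symbol being the number of embeddings of $(G,u,v)$ in $S_i$ with the stated property: - $dd^0_i(G)$: type $dd$, neither fb-walk incident at $u$ is incident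 at $v$; - $dd'_i(G)$: type $dd$, exactly one fb-walk incident at $u$ is incident at $v$; - $dd''_i(G)$: type $dd$, both fb-walks incident at $u$ are incident at $v$; - $ds^0_i(G)$: type $ds$, neither fb-walk incident at $u$ is incident at $v$; - $ds'_i(G)$: type $ds$, one fb-walk incident at $u$ is incident at $v$; - $sd^0_i(G)$: type $sd$, the fb-walk incident at $u$ is not incident at $v$; - $sd'_i(G)$: type $sd$, the fb-walk incident at $u$ is also incident at $v$; - $ss^0_i(G)$: type $ss$, the fb-walk incident at $u$ is not incident at $v$; - $ss^1_i(G)$: type $ss$, the fb-walk incident at $u$ is incident at $v$, and the cyclic pattern of incidences of the roots along it is $uuvv$; - $ss^2_i(G)$: type $ss$, the fb-walk incident at $u$ is incident at $v$, and the cyclic pattern of incidences of the roots along it is $uvuv$. For each symbol, dropping the subscript denotes the generating polynomial, e.g. $ds'(G)=\sum_{i\ge0} ds'_i(G)x^i$. The pgd-vector of $(G,u,v)$ is the row vector of polynomials in $x$ $$V_G=\big(dd^0(G),\ dd'(G),\ dd''(G),\ ds^0(G),\ ds'(G),\ sd^0(G),\ sd'(G),\ ss^0(G),\ ss^1(G),\ ss^2(G)\big).$$ *)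

theory Defs
  imports
    "Graph_Theory.Graph_Theory"
    "HOL-Combinatorics.Orbits"
    "HOL-Computational_Algebra.Polynomial"
    "Jordan_Normal_Form.Matrix"
begin

text \<open>
  A finite graph, possibly with multiple edges and loops, is a finite bidirected digraph \<open>G\<close>
  with arc reversal \<open>arev\<close>.  An undirected edge is a pair \<open>{a, arev a}\<close> of arcs, and the arcs
  with tail \<open>w\<close> are the edge-ends at \<open>w\<close>; so the valence of \<open>w\<close> is \<open>out_degree G w\<close>, and a loop
  contributes two edge-ends.

  A rotation system is a permutation of the edge-ends whose cycles are exactly the sets of
  edge-ends at the individual vertices.
\<close>

definition rotation_systems :: "('a, 'b) pre_digraph \<Rightarrow> ('b \<Rightarrow> 'b) set" where
  "rotation_systems G =
     {\<rho>. \<rho> permutes arcs G \<and>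
         (\<forall>w \<in> verts G. out_arcs G w \<noteq> {} \<longrightarrow> cyclic_on \<rho> (out_arcs G w))}"

text \<open>
  Face tracing: after traversing \<open>a\<close>, one leaves the vertex \<open>head G a\<close> along the successor of the
  edge-end \<open>arev a\<close> in the rotation at that vertex.
\<close>

definition face_succ :: "('b \<Rightarrow> 'b) \<Rightarrow> ('b \<Rightarrow> 'b) \<Rightarrow> 'b \<Rightarrow> 'b" where
  "face_succ arev \<rho> = \<rho> \<circ> arev"

text \<open>
  An fb-walk is represented by the set of arcs it traverses, i.e. a cycle of \<^term>\<open>face_succ arev \<rho>\<close>.
  The one-vertex graph without edges has a single face, bounded by the walk of length 0.
\<close>

definition fb_walks :: "('a, 'b) pre_digraph \<Rightarrow> ('b \<Rightarrow> 'b) \<Rightarrow> ('b \<Rightarrow> 'b) \<Rightarrow> 'b set set" where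
  "fb_walks G arev \<rho> = (if arcs G = {} then {{}} else orbit (face_succ arev \<rho>) ` arcs G)"

definition edges :: "('a, 'b) pre_digraph \<Rightarrow> ('b \<Rightarrow> 'b) \<Rightarrow> 'b set set" where
  "edges G arev = (\<lambda>a. {a, arev a}) ` arcs G"

definition euler_char :: "('a, 'b) pre_digraph \<Rightarrow> ('b \<Rightarrow> 'b) \<Rightarrow> ('b \<Rightarrow> 'b) \<Rightarrow> int" where
  "euler_char G arev \<rho> =
     int (card (verts G)) - int (card (edges G arev)) + int (card (fb_walks G arev \<rho>))"

text \<open>For connected \<open>G\<close>: the embeddings in \<open>S\<^sub>i\<close>, the surface of Euler characteristic \<open>2 - 2i\<close>.\<close>

definition embeddings :: "('a, 'b) pre_digraph \<Rightarrow> ('b \<Rightarrow> 'b) \<Rightarrow> nat \<Rightarrow> ('b \<Rightarrow> 'b) set" where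
  "embeddings G arev i = {\<rho> \<in> rotation_systems G. euler_char G arev \<rho> = 2 - 2 * int i}"

text \<open>
  The generating polynomial of a finitely supported sequence (the support condition is needed for
  \<^const>\<open>Abs_poly\<close> to be meaningful; it holds for all sequences below if \<open>G\<close> is finite, see
  \<open>coeff_genpoly\<close>).
\<close>

definition genpoly :: "(nat \<Rightarrow> nat) \<Rightarrow> int poly" where
  "genpoly c = Abs_poly (\<lambda>i. int (c i))"

definition genus_poly :: "('a, 'b) pre_digraph \<Rightarrow> ('b \<Rightarrow> 'b) \<Rightarrow> int poly" where
  "genus_poly G arev = genpoly (\<lambda>i. card (embeddings G arev i))"

lemma coeff_genpoly:
  assumes "finite (arcs G)"
  shows "coeff (genpoly (\<lambda>i. card {\<rho> \<in> embeddings G arev i. P \<rho>})) i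
           = int (card {\<rho> \<in> embeddings G arev i. P \<rho>})"
proof -
  have "finite (rotation_systems G)"
    by (rule finite_subset[OF _ finite_permutations[OF assms]])
       (auto simp: rotation_systems_def)
  then have fin: "finite ((\<lambda>\<rho>. nat ((2 - euler_char G arev \<rho>) div 2)) ` rotation_systems G)"
    by simp
  have "i \<in> (\<lambda>\<rho>. nat ((2 - euler_char G arev \<rho>) div 2)) ` rotation_systems G"
    if "card {\<rho> \<in> embeddings G arev i. P \<rho>} \<noteq> 0" for i
  proof -
    obtain \<rho> where "\<rho> \<in> embeddings G arev i"
      using \<open>card {\<rho> \<in> embeddings G arev i. P \<rho>} \<noteq> 0\<close> by (fastforce simp: card_eq_0_iff)
    then show ?thesis
      by (intro image_eqI[where x = \<rho>]) (auto simp: embeddings_def)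
  qed
  then have "finite {i. int (card {\<rho> \<in> embeddings G arev i. P \<rho>}) \<noteq> 0}"
    by (intro finite_subset[OF _ fin]) auto
  then have "\<forall>\<^sub>\<infinity>i. int (card {\<rho> \<in> embeddings G arev i. P \<rho>}) = 0"
    by (simp add: MOST_iff_cofinite)
  then show ?thesis
    by (simp add: genpoly_def Abs_poly_inverse)
qed

lemma coeff_genus_poly:
  "finite (arcs G) \<Longrightarrow> coeff (genus_poly G arev) i = int (card (embeddings G arev i))"
  using coeff_genpoly[where P = "\<lambda>_. True"] by (simp add: genus_poly_def)

text \<open>
  Each face-corner at \<open>w\<close> is passed by an fb-walk immediately before it leaves \<open>w\<close> along some
  edge-end \<open>a\<close>; thus the corners at \<open>w\<close> correspond to the arcs in \<^term>\<open>out_arcs G w\<close>, and an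
  fb-walk \<open>F\<close> is incident at \<open>w\<close> exactly \<^term>\<open>card (F \<inter> out_arcs G w)\<close> times.
\<close>

definition fb_at ::
    "('a, 'b) pre_digraph \<Rightarrow> ('b \<Rightarrow> 'b) \<Rightarrow> ('b \<Rightarrow> 'b) \<Rightarrow> 'a \<Rightarrow> 'b set set" where
  "fb_at G arev \<rho> w = {F \<in> fb_walks G arev \<rho>. F \<inter> out_arcs G w \<noteq> {}}"

text \<open>Types \<open>d\<close> and \<open>s\<close> at a 2-valent vertex \<open>w\<close>.\<close>

definition type_d :: "('a, 'b) pre_digraph \<Rightarrow> ('b \<Rightarrow> 'b) \<Rightarrow> ('b \<Rightarrow> 'b) \<Rightarrow> 'a \<Rightarrow> bool" where
  "type_d G arev \<rho> w \<longleftrightarrow> card (fb_at G arev \<rho> w) = 2"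

definition type_s :: "('a, 'b) pre_digraph \<Rightarrow> ('b \<Rightarrow> 'b) \<Rightarrow> ('b \<Rightarrow> 'b) \<Rightarrow> 'a \<Rightarrow> bool" where
  "type_s G arev \<rho> w \<longleftrightarrow> (\<exists>F \<in> fb_walks G arev \<rho>. card (F \<inter> out_arcs G w) = 2)"

definition shared_fb ::
    "('a, 'b) pre_digraph \<Rightarrow> ('b \<Rightarrow> 'b) \<Rightarrow> ('b \<Rightarrow> 'b) \<Rightarrow> 'a \<Rightarrow> 'a \<Rightarrow> 'b set set" where
  "shared_fb G arev \<rho> u v = fb_at G arev \<rho> u \<inter> fb_at G arev \<rho> v"

text \<open>
  \<open>ps\<close> is the sequence of occurrences of \<open>u\<close> and \<open>v\<close> along the closed walk \<open>F\<close>, read from a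
  suitable starting point.
\<close>

definition has_pattern ::
    "('a, 'b) pre_digraph \<Rightarrow> ('b \<Rightarrow> 'b) \<Rightarrow> ('b \<Rightarrow> 'b) \<Rightarrow> 'a \<Rightarrow> 'a \<Rightarrow> 'b set \<Rightarrow> 'a list \<Rightarrow> bool" where
  "has_pattern G arev \<rho> u v F ps \<longleftrightarrow>
     (\<exists>a \<in> F. filter (\<lambda>w. w \<in> {u, v})
        (map (\<lambda>k. tail G ((face_succ arev \<rho> ^^ k) a)) [0..<card F]) = ps)"

context
  fixes G :: "('a, 'b) pre_digraph" and arev :: "'b \<Rightarrow> 'b" and u v :: 'a
begin

definition dd0 :: "nat \<Rightarrow> nat" where
  "dd0 i = card {\<rho> \<in> embeddings G arev i.
     type_d G arev \<rho> u \<and> type_d G arev \<rho> v \<and> card (shared_fb G arev \<rho> u v) = 0}"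

definition dd' :: "nat \<Rightarrow> nat" where
  "dd' i = card {\<rho> \<in> embeddings G arev i.
     type_d G arev \<rho> u \<and> type_d G arev \<rho> v \<and> card (shared_fb G arev \<rho> u v) = 1}"

definition dd'' :: "nat \<Rightarrow> nat" where
  "dd'' i = card {\<rho> \<in> embeddings G arev i.
     type_d G arev \<rho> u \<and> type_d G arev \<rho> v \<and> card (shared_fb G arev \<rho> u v) = 2}"

definition ds0 :: "nat \<Rightarrow> nat" where
  "ds0 i = card {\<rho> \<in> embeddings G arev i.
     type_d G arev \<rho> u \<and> type_s G arev \<rho> v \<and> card (shared_fb G arev \<rho> u v) = 0}"

definition ds' :: "nat \<Rightarrow> nat" where
  "ds' i = card {\<rho> \<in> embeddings G arev i.
     type_d G arev \<rho> u \<and> type_s G arev \<rho> v \<and> card (shared_fb G arev \<rho> u v) = 1}"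

definition sd0 :: "nat \<Rightarrow> nat" where
  "sd0 i = card {\<rho> \<in> embeddings G arev i.
     type_s G arev \<rho> u \<and> type_d G arev \<rho> v \<and> card (shared_fb G arev \<rho> u v) = 0}"

definition sd' :: "nat \<Rightarrow> nat" where
  "sd' i = card {\<rho> \<in> embeddings G arev i.
     type_s G arev \<rho> u \<and> type_d G arev \<rho> v \<and> card (shared_fb G arev \<rho> u v) = 1}"

definition ss0 :: "nat \<Rightarrow> nat" where
  "ss0 i = card {\<rho> \<in> embeddings G arev i.
     type_s G arev \<rho> u \<and> type_s G arev \<rho> v \<and> card (shared_fb G arev \<rho> u v) = 0}"

definition ss1 :: "nat \<Rightarrow> nat" where
  "ss1 i = card {\<rho> \<in> embeddings G arev i.
     type_s G arev \<rho> u \<and> type_s G arev \<rho> v \<and>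
     (\<exists>F \<in> shared_fb G arev \<rho> u v. has_pattern G arev \<rho> u v F [u, u, v, v])}"

definition ss2 :: "nat \<Rightarrow> nat" where
  "ss2 i = card {\<rho> \<in> embeddings G arev i.
     type_s G arev \<rho> u \<and> type_s G arev \<rho> v \<and>
     (\<exists>F \<in> shared_fb G arev \<rho> u v. has_pattern G arev \<rho> u v F [u, v, u, v])}"

definition pgd_vector :: "int poly vec" where
  "pgd_vector = vec_of_list
     [genpoly dd0, genpoly dd', genpoly dd'', genpoly ds0, genpoly ds',
      genpoly sd0, genpoly sd', genpoly ss0, genpoly ss1, genpoly ss2]"

end

text \<open>
  Self-bar-amalgamation: a new edge \<open>uv\<close>, consisting of the arcs \<open>Inr False\<close> from \<open>u\<close> to \<open>v\<close> and
  \<open>Inr True\<close> from \<open>v\<close> to \<open>u\<close>; the old arcs are tagged with \<open>Inl\<close>.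
\<close>

definition self_bar :: "('a, 'b) pre_digraph \<Rightarrow> 'a \<Rightarrow> 'a \<Rightarrow> ('a, 'b + bool) pre_digraph" where
  "self_bar G u v =
     \<lparr> verts = verts G,
       arcs = Inl ` arcs G \<union> {Inr False, Inr True},
       tail = case_sum (tail G) (\<lambda>b. if b then v else u),
       head = case_sum (head G) (\<lambda>b. if b then u else v) \<rparr>"

definition self_bar_rev :: "('b \<Rightarrow> 'b) \<Rightarrow> 'b + bool \<Rightarrow> 'b + bool" where
  "self_bar_rev arev = map_sum arev Not"

lemma fin_digraph_self_bar:
  assumes "fin_digraph G" "u \<in> verts G" "v \<in> verts G"
  shows "fin_digraph (self_bar G u v)"
proof -
  interpret fin_digraph G by fact
  show ?thesis
    using assms(2,3) by unfold_locales (auto simp: self_bar_def)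
qed

lemma bidirected_digraph_self_bar:
  assumes "bidirected_digraph G arev" "u \<in> verts G" "v \<in> verts G"
  shows "bidirected_digraph (self_bar G u v) (self_bar_rev arev)"
proof -
  interpret bidirected_digraph G arev by fact
  show ?thesis
    using assms(2,3) arev_dom
    by unfold_locales
       (auto simp: self_bar_def self_bar_rev_def image_iff map_sum_def split: sum.splits)
qed

end

theory Submission
  imports Defs
begin

text \<open>
  A rotation system of the graph with the new edge \<open>e = uv\<close> arises from exactly one rotation system
  \<open>\<rho>\<close> of \<open>G\<close> by choosing one of the two corners at \<open>u\<close> and one of the two corners at \<open>v\<close> and drawing
  \<open>e\<close> between them (\<open>bij_betw_bar_rotation\<close>).  If the two chosen corners lie on the same fb-walk,
  the new edge splits that walk in two and the surface does not change.  If they lie on different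
  fb-walks, the edge needs a handle, which joins the two walks, and the genus grows by one
  (\<open>euler_char_bar_rotation\<close>).  Hence an embedding of \<open>G\<close> in \<open>S\<^sub>i\<close> for which \<open>n\<close> of the four corner
  pairs lie on a common fb-walk contributes \<open>n x\<^sup>i + (4 - n) x\<^sup>i\<^sup>+\<^sup>1\<close>.

  It remains to read off \<open>n\<close> from the type of the embedding (\<open>card_common_corners\<close>).  It is the
  number of shared fb-walks, each weighted with the product of its numbers of visits to \<open>u\<close> and to
  \<open>v\<close>: \<open>0\<close> for the types with superscript \<open>0\<close>, \<open>1\<close> for \<open>dd'\<close>, \<open>2\<close> for \<open>dd''\<close>, \<open>ds'\<close> and \<open>sd'\<close>, and
  \<open>4\<close> when one walk passes both roots twice.  The last case is split between \<open>ss\<^sup>1\<close> and \<open>ss\<^sup>2\<close>, which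
  are complementary because a cyclic word with two letters \<open>u\<close> and two letters \<open>v\<close> is either
  \<open>uuvv\<close> or \<open>uvuv\<close> (\<open>has_pattern_cases\<close>).

  On the level of permutations, drawing an edge is multiplication by transpositions, and a
  transposition \<open>(a b)\<close> splits the cycle through \<open>a\<close> and \<open>b\<close> or joins their two cycles.
  The same fact, applied to the edges of \<open>G\<close> one at a time, gives the Euler bound
  \<open>V - E + F \<le> 2\<close> (\<open>euler_char_le_2\<close>).  The bound is needed for the constant coefficient:
  an embedding of Euler characteristic \<open>4\<close> would contribute to genus \<open>0\<close> of the new graph but would
  not be counted by the genus distribution of \<open>G\<close>.
\<close>

section \<open>Cycles of a permutation multiplied by a transposition\<close>

lemma orbit_eq_if_in_orbit:
  assumes "permutation f" "y \<in> orbit f x"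
  shows "orbit f y = orbit f x"
  using cyclic_on_orbit'[OF assms(1), of x] assms(2) orbit_cyclic_eq3 by fastforce

lemma in_orbit_iff_orbit_eq:
  assumes "permutation f"
  shows "y \<in> orbit f x \<longleftrightarrow> orbit f y = orbit f x"
  using orbit_eq_if_in_orbit[OF assms] permutation_self_in_orbit[OF assms] by blast

lemma permutation_transpose_comp: "permutation f \<Longrightarrow> permutation (transpose a b \<circ> f)"
  by (simp add: permutation_compose permutation_swap_id)

text \<open>
  Walking along the \<open>f\<close>-cycle of \<open>a\<close>, the two permutations agree until the walk is about to return
  to \<open>a\<close>; there \<open>transpose a b \<circ> f\<close> jumps to \<open>b\<close>.
\<close>
lemma orbit_subset_transpose_comp:
  assumes f: "permutation f" and b: "b \<notin> orbit f a"
  shows "orbit f a \<subseteq> orbit (transpose a b \<circ> f) a" and "b \<in> orbit (transpose a b \<circ> f) a"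
proof -
  define g where "g = transpose a b \<circ> f"
  have g_other: "g y = f y" if "f y \<noteq> a" "f y \<noteq> b" for y
    using that by (simp add: g_def)
  have g_a: "g y = b" if "f y = a" for y
    using that by (simp add: g_def)
  have self: "a \<in> orbit g a"
    unfolding g_def using permutation_self_in_orbit[OF permutation_transpose_comp[OF f]] .
  have *: "orbit f a \<subseteq> orbit g a"
  proof
    fix y assume "y \<in> orbit f a"
    then show "y \<in> orbit g a"
    proof induct
      case base
      have "f a \<noteq> b" using b orbit.base[of f a] by metis
      then show ?case
        using self g_other orbit.base[of g a] by (cases "f a = a") auto
    next
      case (step y)
      have "f y \<noteq> b" using b orbit.step[OF step(1)] by metis
      then show ?case
        using self g_other orbit.step[OF step(2)] by (cases "f y = a") auto
    qed
  qed
  obtain y where y: "y \<in> orbit f a" "f y = a"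
    using permutation_self_in_orbit[OF f, of a]
    by (metis f orbit.cases permutation_self_in_orbit)
  then have "b \<in> orbit g a"
    using orbit.step[of y g a] * g_a by auto
  with * show "orbit f a \<subseteq> orbit (transpose a b \<circ> f) a" "b \<in> orbit (transpose a b \<circ> f) a"
    by (simp_all only: g_def)
qed

lemma orbit_transpose_comp_merge:
  assumes f: "permutation f" and b: "b \<notin> orbit f a"
  shows "orbit (transpose a b \<circ> f) a = orbit f a \<union> orbit f b"
proof
  let ?g = "transpose a b \<circ> f"
  have a: "a \<notin> orbit f b"
    using b f by (simp add: in_orbit_iff_orbit_eq)
  have "orbit ?g b = orbit ?g a"
    using orbit_subset_transpose_comp(2)[OF f b]
    by (intro orbit_eq_if_in_orbit permutation_transpose_comp f)
  then show "orbit f a \<union> orbit f b \<subseteq> orbit ?g a"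
    using orbit_subset_transpose_comp(1)[OF f b] orbit_subset_transpose_comp(1)[OF f a]
    by (simp add: transpose_commute)
  show "orbit ?g a \<subseteq> orbit f a \<union> orbit f b"
  proof
    fix y assume "y \<in> orbit ?g a"
    then show "y \<in> orbit f a \<union> orbit f b"
      using permutation_self_in_orbit[OF f]
      by induct (auto simp: transpose_def intro: orbit.intros)
  qed
qed

lemma orbit_transpose_comp_other:
  assumes "permutation f" "a \<notin> orbit f x" "b \<notin> orbit f x"
  shows "orbit (transpose a b \<circ> f) x = orbit f x"
proof (rule orbit_cong)
  show "x \<in> orbit f x" using permutation_self_in_orbit[OF assms(1)] .
  fix s assume "s \<in> orbit f x"
  then have "f s \<in> orbit f x" by (rule orbit.step)
  then show "(transpose a b \<circ> f) s = f s"
    using assms(2,3) by (auto simp: transpose_def)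
qed

text \<open>
  If \<open>f\<close> leads from \<open>a\<close> to \<open>b\<close>, the modified permutation walks along the segment from \<open>a\<close> to the
  predecessor of \<open>b\<close> and then jumps back to \<open>a\<close>.
\<close>
lemma notin_orbit_transpose_comp:
  assumes f: "permutation f" and b: "b \<in> orbit f a" and ne: "a \<noteq> b"
  shows "b \<notin> orbit (transpose a b \<circ> f) a"
proof -
  let ?g = "transpose a b \<circ> f"
  define n where "n = (LEAST n. (f ^^ n) a = b)"
  have "\<exists>n. (f ^^ n) a = b"
    using b by (auto simp: orbit_altdef)
  then have n: "(f ^^ n) a = b"
    unfolding n_def by (rule LeastI_ex)
  have least: "(f ^^ k) a \<noteq> b" if "k < n" for k
    using that unfolding n_def by (rule not_less_Least)
  \<comment> \<open>the segment from \<open>a\<close> to the predecessor of \<open>b\<close>\<close>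
  let ?S = "(\<lambda>k. (f ^^ k) a) ` {..<n}"
  have pos: "0 < n"
    using n ne by (cases n) auto
  have closed: "?g y \<in> ?S" if y: "y \<in> ?S" for y
  proof -
    from y obtain k where k: "k < n" "y = (f ^^ k) a" by auto
    then have fy: "f y = (f ^^ Suc k) a" by simp
    show ?thesis
    proof (cases "Suc k = n")
      case True
      then have "?g y = a" using fy n by simp
      then show ?thesis using pos by force
    next
      case False
      then have "Suc k < n" using k by simp
      then have "f y \<noteq> b" using least fy by metis
      moreover have "f y \<noteq> a"
      proof
        assume "f y = a"
        then have "(f ^^ (n - Suc k)) a = (f ^^ (n - Suc k + Suc k)) a"
          using fy by (metis comp_apply funpow_add)
        also have "\<dots> = b" using n \<open>Suc k < n\<close> by simp
        finally show False using least[of "n - Suc k"] \<open>Suc k < n\<close> by simp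
      qed
      ultimately have "?g y = (f ^^ Suc k) a" using fy by simp
      then show ?thesis using \<open>Suc k < n\<close> by blast
    qed
  qed
  have "a \<in> ?S" using pos by force
  have "y \<in> ?S" if "y \<in> orbit ?g a" for y
    using that by induct (use closed \<open>a \<in> ?S\<close> in blast)+
  then show ?thesis
    using least by blast
qed

lemma card_orbits_transpose_comp_merge:
  assumes f: "f permutes A" "finite A" and ab: "a \<in> A" "b \<in> A" and b: "b \<notin> orbit f a"
  shows "card (orbit f ` A) = card (orbit (transpose a b \<circ> f) ` A) + 1"
proof -
  let ?g = "transpose a b \<circ> f"
  have pf: "permutation f" using f by (auto simp: permutation_permutes)
  note eq = in_orbit_iff_orbit_eq[OF pf]
  note self = permutation_self_in_orbit[OF pf]
  define R where "R = orbit f ` {x \<in> A. a \<notin> orbit f x \<and> b \<notin> orbit f x}"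
  have f_orbits: "orbit f ` A = insert (orbit f a) (insert (orbit f b) R)"
    using ab by (auto simp: R_def eq)
  have gab: "orbit ?g a = orbit f a \<union> orbit f b"
    using orbit_transpose_comp_merge[OF pf b] .
  have g_eq: "orbit ?g x = orbit f a \<union> orbit f b" if "a \<in> orbit f x \<or> b \<in> orbit f x" for x
  proof -
    have "x \<in> orbit ?g a"
      unfolding gab using that self[of x] by (auto simp: eq)
    then show ?thesis
      using orbit_eq_if_in_orbit[OF permutation_transpose_comp[OF pf]] gab by metis
  qed
  have g_orbits: "orbit ?g ` A = insert (orbit f a \<union> orbit f b) R"
  proof
    show "orbit ?g ` A \<subseteq> insert (orbit f a \<union> orbit f b) R"
    proof (rule image_subsetI)
      fix x assume "x \<in> A"
      then show "orbit ?g x \<in> insert (orbit f a \<union> orbit f b) R"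
        using g_eq[of x] orbit_transpose_comp_other[OF pf, of a x b]
        unfolding R_def by (cases "a \<in> orbit f x \<or> b \<in> orbit f x") blast+
    qed
    have "R \<subseteq> orbit ?g ` A"
      unfolding R_def
      by (rule image_subsetI) (metis (mono_tags, lifting) image_eqI mem_Collect_eq
            orbit_transpose_comp_other[OF pf])
    then show "insert (orbit f a \<union> orbit f b) R \<subseteq> orbit ?g ` A"
      using gab ab by auto
  qed
  have "finite R" using f by (simp add: R_def)
  moreover have "orbit f a \<notin> R" "orbit f b \<notin> R" "orbit f a \<union> orbit f b \<notin> R"
    using self[of a] self[of b] by (auto simp: R_def)
  moreover have "orbit f a \<noteq> orbit f b" using b eq by metis
  ultimately show ?thesis
    by (simp add: f_orbits g_orbits)
qed

text \<open>
  Since a transposition is an involution, the splitting case is the merging case read backwards,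
  from \<open>transpose a b \<circ> f\<close> to \<open>f\<close>.
\<close>
lemma card_orbits_transpose_comp:
  assumes f: "f permutes A" "finite A" and ab: "a \<in> A" "b \<in> A" "a \<noteq> b"
  shows "int (card (orbit (transpose a b \<circ> f) ` A)) =
           int (card (orbit f ` A)) + (if orbit f a = orbit f b then 1 else - 1)"
proof -
  have pf: "permutation f" using f by (auto simp: permutation_permutes)
  show ?thesis
  proof (cases "b \<in> orbit f a")
    case True
    let ?g = "transpose a b \<circ> f"
    have "?g permutes A"
      using f ab by (intro permutes_compose permutes_swap_id)
    moreover have "transpose a b \<circ> ?g = f"
      by (simp add: comp_assoc[symmetric])
    ultimately have "card (orbit ?g ` A) = card (orbit f ` A) + 1"
      using card_orbits_transpose_comp_merge[of ?g A a b] f ab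
        notin_orbit_transpose_comp[OF pf True] by simp
    with True show ?thesis by (simp add: in_orbit_iff_orbit_eq[OF pf])
  next
    case False
    then have "orbit f a \<noteq> orbit f b"
      using in_orbit_iff_orbit_eq[OF pf] by metis
    with card_orbits_transpose_comp_merge[OF f ab(1,2) False] show ?thesis by simp
  qed
qed

text \<open>
  Inserting a new edge-end into a rotation, directly before \<open>a\<close>, means joining its trivial cycle to
  the cycle of \<open>a\<close>; conversely an edge-end is deleted by splitting it off.
\<close>
lemma cyclic_on_insert_fixpoint:
  assumes f: "permutation f" "f x = x" and P: "cyclic_on f P" "a \<in> P" "x \<notin> P"
  shows "cyclic_on (transpose a x \<circ> f) (insert x P)"
proof -
  have "orbit f a = P" using P orbit_cyclic_eq3 by metis
  moreover have "orbit f x = {x}" using f by (simp add: orbit_eq_singleton_iff)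
  ultimately have "orbit (transpose a x \<circ> f) a = insert x P"
    using orbit_transpose_comp_merge[OF f(1), of x a] P by simp
  then show ?thesis using P by (intro cyclic_on_singleI[of a]) auto
qed

lemma cyclic_on_remove_point:
  assumes g: "permutation g" and P: "cyclic_on g (insert x P)" "x \<notin> P" "P \<noteq> {}"
  shows "g x \<in> P" and "cyclic_on (transpose (g x) x \<circ> g) P"
proof -
  define a where "a = g x"
  define f where "f = transpose a x \<circ> g"
  have orb: "orbit g y = insert x P" if "y \<in> insert x P" for y
    using that P(1) orbit_cyclic_eq3 by metis
  have "a \<noteq> x"
    using orb[of x] P orbit_eq_singleton_iff[of g x] by (auto simp: a_def)
  moreover have "a \<in> insert x P" using cyclic_on_inI[OF P(1), of x] by (simp add: a_def)
  ultimately have a: "a \<in> P" by simp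
  have pf: "permutation f" unfolding f_def by (rule permutation_transpose_comp[OF g])
  have "f x = x" by (simp add: f_def a_def)
  then have fx: "orbit f x = {x}" by (simp add: orbit_eq_singleton_iff)
  then have fa: "x \<notin> orbit f a"
    using in_orbit_iff_orbit_eq[OF pf] \<open>a \<noteq> x\<close> permutation_self_in_orbit[OF pf, of a]
    by (metis singletonD)
  have "transpose a x \<circ> f = g" by (simp add: f_def comp_assoc[symmetric])
  then have "orbit f a \<union> {x} = insert x P"
    using orbit_transpose_comp_merge[OF pf fa] fx orb[of a] a by simp
  then have "P = orbit f a" using fa P(2) by auto
  then show "g x \<in> P" "cyclic_on (transpose (g x) x \<circ> g) P"
    using a unfolding a_def[symmetric] f_def[symmetric]
    by (auto intro: cyclic_on_singleI)
qed

section \<open>The genus of an embedding is nonnegative\<close>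

lemma out_arcs_rotation:
  assumes "\<rho> \<in> rotation_systems G" "wf_digraph G" "a \<in> arcs G"
  shows "orbit \<rho> a = out_arcs G (tail G a)" "\<rho> a \<in> arcs G" "tail G (\<rho> a) = tail G a"
proof -
  have "a \<in> out_arcs G (tail G a)" using assms(3) by simp
  moreover have "tail G a \<in> verts G" using assms(2,3) by (rule wf_digraph.tail_in_verts)
  ultimately have "cyclic_on \<rho> (out_arcs G (tail G a))"
    using assms(1) unfolding rotation_systems_def by blast
  then show *: "orbit \<rho> a = out_arcs G (tail G a)"
    using \<open>a \<in> out_arcs G (tail G a)\<close> by (rule orbit_cyclic_eq3)
  then show "\<rho> a \<in> arcs G" "tail G (\<rho> a) = tail G a"
    using orbit.base[of \<rho> a] by auto
qed

text \<open>
  The edges in \<open>L\<close> are glued in one at a time, starting from the vertices with their rotations only: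
  \<open>\<phi> L\<close> is the face permutation of the spanning subgraph with edge set \<open>L\<close>, in which the remaining
  edge-ends stay dangling.  Each new edge either joins two components, and then it also joins two
  cycles of the face permutation, or it creates at most one new cycle.  The vertex labelling \<open>f\<close> is
  constant on components, and it is built so that its image counts them.
\<close>
lemma card_fb_walks_partial_le:
  fixes G :: "('a, 'b) pre_digraph"
  assumes fin: "fin_digraph G" and bi: "bidirected_digraph G arev"
    and \<rho>: "\<rho> \<in> rotation_systems G" and L: "L \<subseteq> edges G arev"
  defines "\<phi> \<equiv> \<lambda>L a. \<rho> (if a \<in> \<Union>L then arev a else a)"
  shows "\<phi> L permutes arcs G \<and>
    (\<exists>f :: 'a \<Rightarrow> 'a. (\<forall>a\<in>\<Union>L. f (tail G a) = f (tail G (arev a))) \<and>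
      int (card (orbit (\<phi> L) ` arcs G)) + int (card (verts G))
        \<le> 2 * int (card (f ` verts G)) + int (card L))"
proof -
  interpret fin_digraph G by fact
  interpret bidirected_digraph G arev by fact
  have wf: "wf_digraph G" by unfold_locales
  have \<rho>_perm: "\<rho> permutes arcs G" using \<rho> by (simp add: rotation_systems_def)
  have "finite L" using L finite_arcs unfolding edges_def by (meson finite_imageI finite_subset)
  then show ?thesis using L
  proof (induction L rule: finite_induct)
    case empty
    have "\<phi> {} = \<rho>" by (simp add: \<phi>_def)
    moreover have "orbit \<rho> ` arcs G \<subseteq> out_arcs G ` verts G"
      using out_arcs_rotation(1)[OF \<rho> wf] by auto
    then have "card (orbit \<rho> ` arcs G) \<le> card (verts G)"
      by (meson card_image_le card_mono finite_imageI finite_verts order_trans)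
    ultimately have "int (card (orbit (\<phi> {}) ` arcs G)) + int (card (verts G))
        \<le> 2 * int (card (id ` verts G)) + int (card ({} :: 'b set set))"
      by simp
    moreover have "\<phi> {} permutes arcs G"
      using \<rho>_perm \<open>\<phi> {} = \<rho>\<close> by simp
    ultimately show ?case by (intro conjI exI[of _ id]) simp_all
  next
    case (insert e L)
    obtain a where a: "a \<in> arcs G" "e = {a, arev a}"
      using insert.prems by (auto simp: edges_def)
    have L_arcs: "b \<in> arcs G" if "b \<in> \<Union>L" for b
      using that insert.prems by (auto simp: edges_def)
    have notin: "b \<notin> \<Union>L" if "b \<in> e" for b
    proof
      assume "b \<in> \<Union>L"
      then obtain c where c: "c \<in> arcs G" "{c, arev c} \<in> L" "b \<in> {c, arev c}"
        using insert.prems by (auto simp: edges_def)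
      then have "{c, arev c} = e" using that a by auto (metis arev_arev)+
      then show False using c insert.hyps by simp
    qed
    from insert obtain f :: "'a \<Rightarrow> 'a" where perm: "\<phi> L permutes arcs G"
      and f: "\<And>b. b \<in> \<Union>L \<Longrightarrow> f (tail G b) = f (tail G (arev b))"
      and le: "int (card (orbit (\<phi> L) ` arcs G)) + int (card (verts G))
                \<le> 2 * int (card (f ` verts G)) + int (card L)"
      by auto
    let ?x = "tail G a" and ?y = "tail G (arev a)"
    have xy: "?x \<in> verts G" "?y \<in> verts G" using a by auto
    have \<phi>a: "\<phi> L a = \<rho> a" "\<phi> L (arev a) = \<rho> (arev a)"
      using notin a by (auto simp: \<phi>_def)
    \<comment> \<open>Gluing in \<open>e\<close> exchanges the images of its two arcs.\<close>
    have step: "\<phi> (insert e L) = transpose (\<rho> a) (\<rho> (arev a)) \<circ> \<phi> L"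
    proof
      fix b
      have inj: "\<phi> L b = \<phi> L c \<longleftrightarrow> b = c" for c
        using permutes_inj[OF perm] by (simp add: inj_eq)
      show "\<phi> (insert e L) b = (transpose (\<rho> a) (\<rho> (arev a)) \<circ> \<phi> L) b"
      proof (cases "b \<in> e")
        case True
        then show ?thesis using a notin[OF True] by (auto simp: \<phi>_def)
      next
        case False
        then have "\<phi> L b \<noteq> \<rho> a" "\<phi> L b \<noteq> \<rho> (arev a)"
          using a inj[of a] inj[of "arev a"] \<phi>a by auto
        moreover have "\<phi> (insert e L) b = \<phi> L b" using False by (simp add: \<phi>_def)
        ultimately show ?thesis by simp
      qed
    qed
    have \<rho>a: "\<rho> a \<in> arcs G" "\<rho> (arev a) \<in> arcs G" "\<rho> a \<noteq> \<rho> (arev a)"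
      using a out_arcs_rotation(2)[OF \<rho> wf] permutes_inj[OF \<rho>_perm] arev_neq[OF a(1)]
      by (auto simp: inj_eq)
    have perm': "\<phi> (insert e L) permutes arcs G"
      unfolding step using perm \<rho>a by (intro permutes_compose permutes_swap_id)
    have count: "int (card (orbit (\<phi> (insert e L)) ` arcs G)) =
        int (card (orbit (\<phi> L) ` arcs G)) +
          (if orbit (\<phi> L) (\<rho> a) = orbit (\<phi> L) (\<rho> (arev a)) then 1 else - 1)"
      unfolding step by (rule card_orbits_transpose_comp[OF perm finite_arcs \<rho>a])
    \<comment> \<open>A cycle of the face permutation stays within one component.\<close>
    have f_\<phi>: "\<phi> L b \<in> arcs G \<and> f (tail G (\<phi> L b)) = f (tail G b)" if "b \<in> arcs G" for b
      using that f[of b] out_arcs_rotation[OF \<rho> wf] by (auto simp: \<phi>_def simp del: tail_arev)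
    have f_orbit: "c \<in> arcs G \<and> f (tail G c) = f (tail G b)"
      if "c \<in> orbit (\<phi> L) b" "b \<in> arcs G" for b c
      using that by induct (simp_all add: f_\<phi>)
    have cardL: "int (card (insert e L)) = int (card L) + 1" using insert.hyps by simp
    show ?case
    proof (cases "f ?x = f ?y")
      case True
      then have "\<forall>b\<in>\<Union>(insert e L). f (tail G b) = f (tail G (arev b))"
        using f a by auto
      moreover have "int (card (orbit (\<phi> (insert e L)) ` arcs G)) + int (card (verts G))
        \<le> 2 * int (card (f ` verts G)) + int (card (insert e L))"
        using le count cardL by (auto split: if_splits)
      ultimately show ?thesis using perm' by blast
    next
      case False
      have "orbit (\<phi> L) (\<rho> a) \<noteq> orbit (\<phi> L) (\<rho> (arev a))"
      proof
        assume "orbit (\<phi> L) (\<rho> a) = orbit (\<phi> L) (\<rho> (arev a))"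
        then have "f (tail G (\<rho> a)) = f (tail G (\<rho> (arev a)))"
          using f_orbit[OF _ \<rho>a(1)] f_orbit[OF _ \<rho>a(2)] orbit.base by metis
        then show False
          using False a out_arcs_rotation(3)[OF \<rho> wf] by simp
      qed
      then have le': "int (card (orbit (\<phi> (insert e L)) ` arcs G)) =
          int (card (orbit (\<phi> L) ` arcs G)) - 1"
        using count by simp
      \<comment> \<open>Merge the two components by giving the label of \<open>?x\<close> to the component of \<open>?y\<close>.\<close>
      define f' where "f' = (\<lambda>z. if f z = f ?y then f ?x else f z)"
      have "f ` verts G = insert (f ?y) (f' ` verts G)"
        using xy by (auto simp: f'_def)
      moreover have "f ?y \<notin> f' ` verts G"
        using False by (auto simp: f'_def split: if_splits)
      ultimately have "card (f ` verts G) = card (f' ` verts G) + 1" by simp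
      then have "int (card (orbit (\<phi> (insert e L)) ` arcs G)) + int (card (verts G))
        \<le> 2 * int (card (f' ` verts G)) + int (card (insert e L))"
        using le le' cardL by simp
      moreover have "\<forall>b\<in>\<Union>(insert e L). f' (tail G b) = f' (tail G (arev b))"
        using f a by (auto simp: f'_def simp del: tail_arev)
      ultimately show ?thesis using perm' by blast
    qed
  qed
qed

lemma euler_char_le_2:
  fixes G :: "('a, 'b) pre_digraph"
  assumes fin: "fin_digraph G" and bi: "bidirected_digraph G arev" and conn: "connected G"
    and \<rho>: "\<rho> \<in> rotation_systems G" and ne: "arcs G \<noteq> {}"
  shows "euler_char G arev \<rho> \<le> 2"
proof -
  interpret fin_digraph G by fact
  interpret bidirected_digraph G arev by fact
  have arcs: "\<Union>(edges G arev) = arcs G" by (auto simp: edges_def)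
  have \<phi>: "(\<lambda>a. \<rho> (if a \<in> arcs G then arev a else a)) = face_succ arev \<rho>"
    by (auto simp: face_succ_def fun_eq_iff arev_eq)
  obtain f :: "'a \<Rightarrow> 'a" where f: "\<And>a. a \<in> arcs G \<Longrightarrow> f (tail G a) = f (tail G (arev a))"
    and le: "int (card (fb_walks G arev \<rho>)) + int (card (verts G))
               \<le> 2 * int (card (f ` verts G)) + int (card (edges G arev))"
    using card_fb_walks_partial_le[OF fin bi \<rho> order_refl] ne
    unfolding arcs \<phi> by (auto simp: fb_walks_def simp del: tail_arev)
  have const: "f w = f z" if "w \<rightarrow>\<^sup>*\<^bsub>G\<^esub> z" for w z
    using that
  proof (induct rule: reachable_induct)
    case (step x y)
    then obtain a where "a \<in> arcs G" "tail G a = x" "head G a = y" by auto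
    then show ?case using f[of a] step by simp
  qed simp
  have "strongly_connected G"
    using symmetric_connected_imp_strongly_connected sym_arcs conn by blast
  then obtain w where "w \<in> verts G" "f ` verts G \<subseteq> {f w}"
    using const by (fastforce simp: strongly_connected_def)
  then have "card (f ` verts G) \<le> 1"
    using card_mono[of "{f w}" "f ` verts G"] by simp
  then show ?thesis using le by (simp add: euler_char_def)
qed

section \<open>Rotation systems of the graph with the added edge\<close>

text \<open>
  The end of the new edge at \<open>u\<close> is placed in the corner directly before \<open>a\<close>, its end at \<open>v\<close> in the
  corner directly before \<open>c\<close>: the two transpositions redirect the predecessors of \<open>a\<close> and \<open>c\<close> to the
  new edge-ends.
\<close>
definition bar_rotation :: "('b \<Rightarrow> 'b) \<Rightarrow> 'b \<Rightarrow> 'b \<Rightarrow> 'b + bool \<Rightarrow> 'b + bool" where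
  "bar_rotation \<rho> a c =
     transpose (Inl a) (Inr False) \<circ> (transpose (Inl c) (Inr True) \<circ> map_sum \<rho> id)"

lemma map_sum_permutes_Inl_image:
  assumes "\<rho> permutes A"
  shows "map_sum \<rho> id permutes Inl ` A"
proof (rule bij_imp_permutes)
  have "inj_on (map_sum \<rho> id) (Inl ` A :: ('a + 'b) set)"
    using permutes_inj[OF assms] by (auto simp: inj_on_def)
  moreover have "map_sum \<rho> id ` (Inl ` A) = (Inl ` A :: ('a + 'b) set)"
    using permutes_image[OF assms] by (force simp: image_image)
  ultimately show "bij_betw (map_sum \<rho> id) (Inl ` A) (Inl ` A :: ('a + 'b) set)"
    by (simp add: bij_betw_def)
  show "map_sum \<rho> id x = x" if "x \<notin> Inl ` A" for x :: "'a + 'b"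
    using that permutes_not_in[OF assms] by (cases x) auto
qed

lemma permutes_Inl_imageE:
  assumes "f permutes Inl ` A"
  obtains \<rho> where "\<rho> permutes A" "f = map_sum \<rho> id"
proof
  define \<rho> where "\<rho> = projl \<circ> f \<circ> Inl"
  have Inl: "f (Inl x) = Inl (\<rho> x)" for x
    using permutes_in_image[OF assms, of "Inl x"] permutes_not_in[OF assms, of "Inl x"]
    by (cases "x \<in> A") (auto simp: \<rho>_def)
  show "f = map_sum \<rho> id"
  proof
    fix x show "f x = map_sum \<rho> id x"
      using Inl permutes_not_in[OF assms, of x] by (cases x) auto
  qed
  show "\<rho> permutes A"
  proof (rule bij_imp_permutes)
    show "bij_betw \<rho> A A"
    proof (rule bij_betwI')
      show "\<rho> x = \<rho> y \<longleftrightarrow> x = y" for x y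
        using Inl permutes_inj[OF assms] by (metis injD sum.inject(1))
      show "\<rho> x \<in> A" if "x \<in> A" for x
        using permutes_in_image[OF assms, of "Inl x"] Inl that by auto
      show "\<exists>x\<in>A. y = \<rho> x" if "y \<in> A" for y
      proof -
        have "Inl y \<in> f ` (Inl ` A)" using permutes_image[OF assms] that by auto
        then show ?thesis using Inl by auto
      qed
    qed
    show "\<rho> x = x" if "x \<notin> A" for x
      using permutes_not_in[OF assms, of "Inl x"] that Inl by auto
  qed
qed

lemma orbit_map_sum_Inl: "orbit (map_sum f g) (Inl x) = Inl ` orbit f x"
proof
  show "orbit (map_sum f g) (Inl x) \<subseteq> Inl ` orbit f x"
  proof
    fix y assume "y \<in> orbit (map_sum f g) (Inl x)"
    then show "y \<in> Inl ` orbit f x"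
      by induct (auto intro: orbit.intros)
  qed
  show "Inl ` orbit f x \<subseteq> orbit (map_sum f g) (Inl x)"
  proof safe
    fix y assume "y \<in> orbit f x"
    then show "Inl y \<in> orbit (map_sum f g) (Inl x)"
    proof induct
      case base
      show ?case using orbit.base[of "map_sum f g" "Inl x"] by simp
    next
      case (step y)
      show ?case using orbit.step[OF step(2)] by simp
    qed
  qed
qed

lemma cyclic_on_map_sum_Inl: "cyclic_on (map_sum f g) (Inl ` S) \<longleftrightarrow> cyclic_on f S"
  by (auto simp: cyclic_on_def orbit_map_sum_Inl inj_image_eq_iff)

lemma out_arcs_self_bar:
  "out_arcs (self_bar G u v) w =
     Inl ` out_arcs G w \<union> (if w = u then {Inr False} else {}) \<union> (if w = v then {Inr True} else {})"
  by (auto simp: self_bar_def split: if_splits)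

lemma verts_self_bar [simp]: "verts (self_bar G u v) = verts G"
  by (simp add: self_bar_def)

lemma arcs_self_bar [simp]:
  "arcs (self_bar G u v) = insert (Inr False) (insert (Inr True) (Inl ` arcs G))"
  by (auto simp: self_bar_def)

lemma bar_rotation_new:
  assumes "a \<noteq> c"
  shows "bar_rotation \<rho> a c (Inr False) = Inl a" "bar_rotation \<rho> a c (Inr True) = Inl c"
  using assms by (auto simp: bar_rotation_def)

lemma cyclic_on_transpose_comp_other:
  assumes "permutation f" "cyclic_on f S" "a \<notin> S" "b \<notin> S"
  shows "cyclic_on (transpose a b \<circ> f) S"
proof -
  obtain s where s: "s \<in> S" "S = orbit f s"
    using assms(2) by (auto simp: cyclic_on_def)
  then show ?thesis
    using orbit_transpose_comp_other[OF assms(1), of a s b] assms(3,4)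
    by (auto intro: cyclic_on_singleI)
qed

lemma bar_rotation_in_rotation_systems:
  fixes G :: "('a, 'b) pre_digraph"
  assumes G: "finite (arcs G)" "u \<in> verts G" "v \<in> verts G" and uv: "u \<noteq> v"
    and \<rho>: "\<rho> \<in> rotation_systems G" and a: "a \<in> out_arcs G u" and c: "c \<in> out_arcs G v"
  shows "bar_rotation \<rho> a c \<in> rotation_systems (self_bar G u v)"
proof -
  define f0 where "f0 = (map_sum \<rho> id :: 'b + bool \<Rightarrow> 'b + bool)"
  define f1 where "f1 = transpose (Inl c) (Inr True) \<circ> f0"
  define f2 where "f2 = transpose (Inl a) (Inr False) \<circ> f1"
  have f2: "bar_rotation \<rho> a c = f2"
    by (simp add: bar_rotation_def f2_def f1_def f0_def)
  have p0: "f0 permutes Inl ` arcs G"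
    unfolding f0_def using \<rho> by (intro map_sum_permutes_Inl_image) (simp add: rotation_systems_def)
  have p1: "f1 permutes insert (Inr True) (Inl ` arcs G)"
    unfolding f1_def using c
    by (intro permutes_compose permutes_swap_id permutes_subset[OF p0]) auto
  have p2: "f2 permutes arcs (self_bar G u v)"
    unfolding f2_def using a
    by (intro permutes_compose permutes_swap_id permutes_subset[OF p1]) auto
  have perm: "permutation f0" "permutation f1"
    using permutes_imp_permutation[OF _ p0] permutes_imp_permutation[OF _ p1] G(1) by simp_all
  have cyc0: "cyclic_on f0 (Inl ` out_arcs G w)" if "w \<in> verts G" "out_arcs G w \<noteq> {}" for w
    using \<rho> that unfolding f0_def cyclic_on_map_sum_Inl rotation_systems_def by blast
  have cyc1v: "cyclic_on f1 (insert (Inr True) (Inl ` out_arcs G v))"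
    unfolding f1_def using perm c G by (intro cyclic_on_insert_fixpoint cyc0) (auto simp: f0_def)
  have cyc1: "cyclic_on f1 (Inl ` out_arcs G w)"
    if "w \<in> verts G" "out_arcs G w \<noteq> {}" "w \<noteq> v" for w
    unfolding f1_def using that c perm by (intro cyclic_on_transpose_comp_other cyc0) auto
  have cyc2u: "cyclic_on f2 (insert (Inr False) (Inl ` out_arcs G u))"
    unfolding f2_def
    using perm a G uv by (intro cyclic_on_insert_fixpoint cyc1) (auto simp: f0_def f1_def)
  have cyc2v: "cyclic_on f2 (insert (Inr True) (Inl ` out_arcs G v))"
    unfolding f2_def using a uv perm by (intro cyclic_on_transpose_comp_other cyc1v) auto
  have cyc2: "cyclic_on f2 (Inl ` out_arcs G w)"
    if "w \<in> verts G" "out_arcs G w \<noteq> {}" "w \<noteq> u" "w \<noteq> v" for w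
    unfolding f2_def using that a perm by (intro cyclic_on_transpose_comp_other cyc1) auto
  show ?thesis
    unfolding f2 rotation_systems_def
    using p2 cyc2u cyc2v cyc2 uv by (auto simp: out_arcs_self_bar)
qed

text \<open>
  The two chosen corners are recovered as the successors of the two new edge-ends, which are then
  deleted one after the other.
\<close>
lemma rotation_systems_self_barE:
  fixes G :: "('a, 'b) pre_digraph"
  assumes G: "finite (arcs G)" "u \<in> verts G" "v \<in> verts G" and uv: "u \<noteq> v"
    and ne: "out_arcs G u \<noteq> {}" "out_arcs G v \<noteq> {}"
    and \<rho>': "\<rho>' \<in> rotation_systems (self_bar G u v)"
  obtains \<rho> a c where "\<rho> \<in> rotation_systems G" "a \<in> out_arcs G u" "c \<in> out_arcs G v"
    "\<rho>' = bar_rotation \<rho> a c"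
proof -
  have p2: "\<rho>' permutes arcs (self_bar G u v)"
    using \<rho>' by (simp add: rotation_systems_def)
  have cyc2: "cyclic_on \<rho>' (out_arcs (self_bar G u v) w)"
    if "w \<in> verts G" "out_arcs G w \<noteq> {}" for w
  proof -
    have "out_arcs (self_bar G u v) w \<noteq> {}" using that by (auto simp: out_arcs_self_bar)
    then show ?thesis using \<rho>' that unfolding rotation_systems_def by simp
  qed
  have cyc2u: "cyclic_on \<rho>' (insert (Inr False) (Inl ` out_arcs G u))"
    using cyc2[of u] G uv ne by (simp add: out_arcs_self_bar)
  have cyc2v: "cyclic_on \<rho>' (insert (Inr True) (Inl ` out_arcs G v))"
    using cyc2[of v] G uv ne by (simp add: out_arcs_self_bar)
  have cyc2w: "cyclic_on \<rho>' (Inl ` out_arcs G w)"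
    if "w \<in> verts G" "out_arcs G w \<noteq> {}" "w \<noteq> u" "w \<noteq> v" for w
    using cyc2[of w] that by (simp add: out_arcs_self_bar)
  have perm2: "permutation \<rho>'"
    using permutes_imp_permutation[OF _ p2] G(1) by simp
  have new: "Inr b \<notin> Inl ` out_arcs G w" "Inl ` out_arcs G u \<noteq> {}" "Inl ` out_arcs G v \<noteq> {}"
    for b :: bool and w
    using ne by auto
  obtain a where a: "a \<in> out_arcs G u" "\<rho>' (Inr False) = Inl a"
    using cyclic_on_remove_point(1)[OF perm2 cyc2u new(1,2)] by blast
  define f1 where "f1 = transpose (Inl a) (Inr False) \<circ> \<rho>'"
  have f1_fix: "f1 (Inr False) = Inr False" by (simp add: f1_def a)
  have p1: "f1 permutes insert (Inr True) (Inl ` arcs G)"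
  proof (rule permutes_superset)
    show "f1 permutes arcs (self_bar G u v)"
      unfolding f1_def using a by (intro permutes_compose permutes_swap_id p2) auto
  qed (use f1_fix in auto)
  have perm1: "permutation f1"
    unfolding f1_def by (rule permutation_transpose_comp[OF perm2])
  have cyc1u: "cyclic_on f1 (Inl ` out_arcs G u)"
    using cyclic_on_remove_point(2)[OF perm2 cyc2u new(1,2)] a by (simp add: f1_def)
  have cyc1v: "cyclic_on f1 (insert (Inr True) (Inl ` out_arcs G v))"
    unfolding f1_def using a uv perm2 by (intro cyclic_on_transpose_comp_other cyc2v) auto
  have cyc1w: "cyclic_on f1 (Inl ` out_arcs G w)"
    if "w \<in> verts G" "out_arcs G w \<noteq> {}" "w \<noteq> u" "w \<noteq> v" for w
    unfolding f1_def using that a perm2 by (intro cyclic_on_transpose_comp_other cyc2w) auto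
  obtain c where c: "c \<in> out_arcs G v" "f1 (Inr True) = Inl c"
    using cyclic_on_remove_point(1)[OF perm1 cyc1v new(1,3)] by blast
  define f0 where "f0 = transpose (Inl c) (Inr True) \<circ> f1"
  have "f0 (Inr True) = Inr True" by (simp add: f0_def c)
  have p0: "f0 permutes Inl ` arcs G"
  proof (rule permutes_superset)
    show "f0 permutes insert (Inr True) (Inl ` arcs G)"
      unfolding f0_def using c by (intro permutes_compose permutes_swap_id p1) auto
  qed (use \<open>f0 (Inr True) = Inr True\<close> in auto)
  have cyc0v: "cyclic_on f0 (Inl ` out_arcs G v)"
    using cyclic_on_remove_point(2)[OF perm1 cyc1v new(1,3)] c by (simp add: f0_def)
  have cyc0: "cyclic_on f0 (Inl ` out_arcs G w)"
    if "w \<in> verts G" "out_arcs G w \<noteq> {}" "w \<noteq> v" for w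
  proof -
    have "cyclic_on f1 (Inl ` out_arcs G w)" using cyc1u cyc1w that by metis
    then show ?thesis
      unfolding f0_def using that c perm1 by (intro cyclic_on_transpose_comp_other) auto
  qed
  obtain \<rho> where \<rho>: "\<rho> permutes arcs G" "f0 = map_sum \<rho> id"
    using permutes_Inl_imageE[OF p0] .
  have "cyclic_on f0 (Inl ` out_arcs G w)" if "w \<in> verts G" "out_arcs G w \<noteq> {}" for w
    using cyc0 cyc0v that by metis
  then have "\<rho> \<in> rotation_systems G"
    using \<rho> unfolding rotation_systems_def by (simp add: cyclic_on_map_sum_Inl)
  moreover have "\<rho>' = bar_rotation \<rho> a c"
    unfolding bar_rotation_def \<rho>(2)[symmetric] f0_def f1_def
    by (simp add: fun_eq_iff)
  ultimately show ?thesis using that a c by blast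
qed

lemma bij_betw_bar_rotation:
  fixes G :: "('a, 'b) pre_digraph"
  assumes "finite (arcs G)" "u \<in> verts G" "v \<in> verts G" "u \<noteq> v"
    and "out_arcs G u \<noteq> {}" "out_arcs G v \<noteq> {}"
  shows "bij_betw (\<lambda>(\<rho>, a, c). bar_rotation \<rho> a c)
    (rotation_systems G \<times> out_arcs G u \<times> out_arcs G v) (rotation_systems (self_bar G u v))"
    (is "bij_betw ?h ?D ?R")
proof (rule bij_betw_imageI)
  show "inj_on ?h ?D"
  proof (rule inj_onI)
    fix p q assume "p \<in> ?D" "q \<in> ?D" "?h p = ?h q"
    then obtain \<rho>1 a1 c1 \<rho>2 a2 c2 where pq: "p = (\<rho>1, a1, c1)" "q = (\<rho>2, a2, c2)"
      and eq: "bar_rotation \<rho>1 a1 c1 = bar_rotation \<rho>2 a2 c2"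
      and "tail G a1 = u" "tail G c1 = v" "tail G a2 = u" "tail G c2 = v"
      by auto
    then have "a1 \<noteq> c1" "a2 \<noteq> c2" using assms(4) by auto
    then have ac: "a1 = a2" "c1 = c2"
      using bar_rotation_new[of a1 c1 \<rho>1] bar_rotation_new[of a2 c2 \<rho>2] eq by auto
    have "map_sum \<rho> id = transpose (Inl c) (Inr True) \<circ>
        (transpose (Inl a) (Inr False) \<circ> bar_rotation \<rho> a c)" for \<rho> and a c :: 'b
      by (simp add: bar_rotation_def fun_eq_iff)
    then have eq': "map_sum \<rho>1 id = (map_sum \<rho>2 id :: 'b + bool \<Rightarrow> _)"
      using eq ac by metis
    have "\<rho>1 x = \<rho>2 x" for x
      using fun_cong[OF eq', of "Inl x"] by simp
    then show "p = q" using pq ac by auto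
  qed
  show "?h ` ?D = ?R"
  proof
    show "?h ` ?D \<subseteq> ?R"
      using bar_rotation_in_rotation_systems[OF assms(1-4)] by auto
    show "?R \<subseteq> ?h ` ?D"
    proof
      fix \<rho>' assume "\<rho>' \<in> ?R"
      then obtain \<rho> a c where "\<rho> \<in> rotation_systems G" "a \<in> out_arcs G u" "c \<in> out_arcs G v"
        "\<rho>' = bar_rotation \<rho> a c"
        by (rule rotation_systems_self_barE[OF assms])
      then show "\<rho>' \<in> ?h ` ?D"
        by (intro image_eqI[where x = "(\<rho>, a, c)"]) auto
    qed
  qed
qed

section \<open>The Euler characteristic after adding the edge\<close>

text \<open>
  Before the new edge is attached at its two corners, its two arcs form a cycle of their own, on
  which the face permutation is \<open>Not\<close>.
\<close>
lemma face_succ_bar_rotation: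
  "face_succ (self_bar_rev arev) (bar_rotation \<rho> a c) =
     transpose (Inl a) (Inr False) \<circ>
       (transpose (Inl c) (Inr True) \<circ> map_sum (face_succ arev \<rho>) Not)"
  by (simp add: face_succ_def self_bar_rev_def bar_rotation_def comp_assoc map_sum.comp)

lemma card_edges_self_bar:
  fixes G :: "('a, 'b) pre_digraph"
  assumes "finite (arcs G)"
  shows "card (edges (self_bar G u v) (self_bar_rev arev)) = card (edges G arev) + 1"
proof -
  have "edges (self_bar G u v) (self_bar_rev arev) =
      insert {Inr False, Inr True} ((`) Inl ` edges G arev)"
    by (auto simp: edges_def self_bar_rev_def image_image)
  moreover have "{Inr False, Inr True} \<notin> (`) Inl ` edges G arev" by auto
  moreover have "finite (edges G arev)" using assms by (simp add: edges_def)
  moreover have "card ((`) (Inl :: 'b \<Rightarrow> 'b + bool) ` edges G arev) = card (edges G arev)"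
    by (intro card_image inj_onI) (simp add: inj_image_eq_iff)
  ultimately show ?thesis by simp
qed

lemma face_succ_permutes:
  assumes "bidirected_digraph G arev" "\<rho> \<in> rotation_systems G"
  shows "face_succ arev \<rho> permutes arcs G"
  unfolding face_succ_def
  using assms bidirected_digraph.arev_permutes_arcs[OF assms(1)]
  by (intro permutes_compose) (auto simp: rotation_systems_def)

text \<open>
  The first transposition always joins the cycle of the new edge to the fb-walk of the corner \<open>c\<close>,
  as if the edge were hung into that face with one end loose.  The second one attaches the loose
  end at the corner \<open>a\<close>; it splits the walk if \<open>a\<close> lies on the same fb-walk and joins two walks
  otherwise.  So the number of faces changes by \<open>1\<close> or \<open>- 1\<close>, while one edge is gained.
\<close>
lemma euler_char_bar_rotation:
  fixes G :: "('a, 'b) pre_digraph"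
  assumes fin: "finite (arcs G)" and bi: "bidirected_digraph G arev"
    and \<rho>: "\<rho> \<in> rotation_systems G"
    and a: "a \<in> arcs G" and c: "c \<in> arcs G" and ac: "a \<noteq> c"
  shows "euler_char (self_bar G u v) (self_bar_rev arev) (bar_rotation \<rho> a c) =
    euler_char G arev \<rho> -
      (if orbit (face_succ arev \<rho>) a = orbit (face_succ arev \<rho>) c then 0 else 2)"
proof -
  define \<phi> where "\<phi> = face_succ arev \<rho>"
  let ?A' = "arcs (self_bar G u v)"
  define \<psi>0 where "\<psi>0 = (map_sum \<phi> Not :: 'b + bool \<Rightarrow> 'b + bool)"
  define \<psi>1 where "\<psi>1 = transpose (Inl c) (Inr True) \<circ> \<psi>0"
  define \<psi>2 where "\<psi>2 = transpose (Inl a) (Inr False) \<circ> \<psi>1"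
  have \<psi>2: "face_succ (self_bar_rev arev) (bar_rotation \<rho> a c) = \<psi>2"
    by (simp add: face_succ_bar_rotation \<psi>2_def \<psi>1_def \<psi>0_def \<phi>_def)
  have \<phi>: "\<phi> permutes arcs G"
    unfolding \<phi>_def by (rule face_succ_permutes[OF bi \<rho>])
  have fin': "finite ?A'" using fin by simp
  have "\<psi>0 = transpose (Inr False) (Inr True) \<circ> map_sum \<phi> id"
    by (auto simp: fun_eq_iff \<psi>0_def transpose_def map_sum_def split: sum.splits)
  then have p0: "\<psi>0 permutes ?A'"
    by (auto intro!: permutes_compose permutes_swap_id
          permutes_subset[OF map_sum_permutes_Inl_image[OF \<phi>]])
  have p1: "\<psi>1 permutes ?A'"
    unfolding \<psi>1_def using c by (intro permutes_compose permutes_swap_id p0) auto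
  have perm: "permutation \<phi>" "permutation \<psi>0" "permutation \<psi>1"
    using permutes_imp_permutation \<phi> p0 p1 fin fin' by blast+
  have Inl: "orbit \<psi>0 (Inl x) = Inl ` orbit \<phi> x" for x
    unfolding \<psi>0_def by (rule orbit_map_sum_Inl)
  have "Inr False \<in> orbit \<psi>0 (Inr True)"
    using orbit.base[of \<psi>0 "Inr True"] by (simp add: \<psi>0_def)
  then have Inr_eq: "orbit \<psi>0 (Inr False) = orbit \<psi>0 (Inr True)"
    by (rule orbit_eq_if_in_orbit[OF perm(2)])
  have Inr_sub: "y \<in> range Inr" if "y \<in> orbit \<psi>0 (Inr True)" for y
    using that by induct (auto simp: \<psi>0_def)
  have "orbit \<psi>0 ` ?A' = insert (orbit \<psi>0 (Inr True)) ((`) Inl ` orbit \<phi> ` arcs G)"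
    by (simp add: Inr_eq Inl image_image)
  moreover have "orbit \<psi>0 (Inr True) \<notin> (`) Inl ` orbit \<phi> ` arcs G"
    using permutation_self_in_orbit[OF perm(2), of "Inr True"] by auto
  moreover have "card ((`) (Inl :: 'b \<Rightarrow> 'b + bool) ` orbit \<phi> ` arcs G) = card (orbit \<phi> ` arcs G)"
    by (intro card_image inj_onI) (simp add: inj_image_eq_iff)
  ultimately have n0: "card (orbit \<psi>0 ` ?A') = card (orbit \<phi> ` arcs G) + 1"
    using fin by simp
  have notin: "Inr True \<notin> orbit \<psi>0 (Inl c)" by (auto simp: Inl)
  have "int (card (orbit \<psi>1 ` ?A')) = int (card (orbit \<psi>0 ` ?A')) - 1"
    unfolding \<psi>1_def using card_orbits_transpose_comp_merge[OF p0 fin' _ _ notin] c by simp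
  moreover have "orbit \<psi>1 (Inl c) = orbit \<psi>0 (Inl c) \<union> orbit \<psi>0 (Inr True)"
    unfolding \<psi>1_def by (rule orbit_transpose_comp_merge[OF perm(2) notin])
  then have "Inr False \<in> orbit \<psi>1 (Inl c)" "Inl a \<in> orbit \<psi>1 (Inl c) \<longleftrightarrow> a \<in> orbit \<phi> c"
    using \<open>Inr False \<in> orbit \<psi>0 (Inr True)\<close> Inr_sub by (auto simp: Inl)
  then have "orbit \<psi>1 (Inl a) = orbit \<psi>1 (Inr False) \<longleftrightarrow> orbit \<phi> a = orbit \<phi> c"
    by (metis in_orbit_iff_orbit_eq perm(1,3))
  then have "int (card (orbit \<psi>2 ` ?A')) =
      int (card (orbit \<psi>1 ` ?A')) + (if orbit \<phi> a = orbit \<phi> c then 1 else - 1)"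
    unfolding \<psi>2_def using card_orbits_transpose_comp[OF p1 fin', of "Inl a" "Inr False"] a by simp
  ultimately have "int (card (orbit \<psi>2 ` ?A')) =
      int (card (orbit \<phi> ` arcs G)) + (if orbit \<phi> a = orbit \<phi> c then 1 else - 1)"
    using n0 by simp
  moreover have "fb_walks (self_bar G u v) (self_bar_rev arev) (bar_rotation \<rho> a c) = orbit \<psi>2 ` ?A'"
    by (simp add: fb_walks_def \<psi>2)
  moreover have "fb_walks G arev \<rho> = orbit \<phi> ` arcs G"
    using a by (auto simp: fb_walks_def \<phi>_def)
  ultimately show ?thesis
    by (simp add: euler_char_def card_edges_self_bar[OF fin] \<phi>_def)
qed

section \<open>Order of the roots along a face-boundary walk\<close>

lemma funpow_card_orbit:
  assumes "permutation f"
  shows "(f ^^ card (orbit f x)) x = x"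
    and "distinct (map (\<lambda>k. (f ^^ k) x) [0..<card (orbit f x)])"
    and "set (map (\<lambda>k. (f ^^ k) x) [0..<card (orbit f x)]) = orbit f x"
proof -
  have self: "x \<in> orbit f x" by (rule permutation_self_in_orbit[OF assms])
  obtain n where n: "n = funpow_dist1 f x x" by blast
  have inj: "inj_on (\<lambda>n. (f ^^ n) x) {0..<n}"
    unfolding n by (rule inj_on_funpow_dist1[OF self])
  have orb: "orbit f x = (\<lambda>n. (f ^^ n) x) ` {0..<n}"
    unfolding n by (rule orbit_conv_funpow_dist1[OF self])
  have card: "card (orbit f x) = n"
    using card_image[OF inj] orb by simp
  show "(f ^^ card (orbit f x)) x = x"
    unfolding card n by (rule funpow_dist1_prop[OF self])
  show "distinct (map (\<lambda>k. (f ^^ k) x) [0..<card (orbit f x)])"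
    using inj unfolding card distinct_map by simp
  show "set (map (\<lambda>k. (f ^^ k) x) [0..<card (orbit f x)]) = orbit f x"
    unfolding card using orb by simp
qed

lemma funpow_list_rotate:
  assumes "(f ^^ n) x = x"
  shows "map (\<lambda>k. (f ^^ k) ((f ^^ m) x)) [0..<n] = rotate m (map (\<lambda>k. (f ^^ k) x) [0..<n])"
proof (rule nth_equalityI)
  fix i assume i: "i < length (map (\<lambda>k. (f ^^ k) ((f ^^ m) x)) [0..<n])"
  have "(f ^^ (k mod n)) x = (f ^^ k) x" for k
    using funpow_mod_eq[OF assms] .
  then show "map (\<lambda>k. (f ^^ k) ((f ^^ m) x)) [0..<n] ! i =
      rotate m (map (\<lambda>k. (f ^^ k) x) [0..<n]) ! i"
    using i by (simp add: nth_rotate add.commute flip: funpow_add[THEN fun_cong, simplified comp_def])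
qed simp

text \<open>
  Starting a closed walk at another place rotates the list of its vertices.  The next three lemmas
  show that the words obtained by keeping only the root vertices are then exactly the rotations of
  one such word.
\<close>
lemma filter_rotate_ex:
  "\<exists>k. filter P (rotate n xs) = rotate k (filter P xs)"
proof -
  have "filter P (rotate n xs) =
      filter P (drop (n mod length xs) xs) @ filter P (take (n mod length xs) xs)"
    by (simp add: rotate_drop_take)
  also have "\<dots> = rotate (length (filter P (take (n mod length xs) xs)))
      (filter P (take (n mod length xs) xs) @ filter P (drop (n mod length xs) xs))"
    by (simp only: rotate_append)
  also have "filter P (take (n mod length xs) xs) @ filter P (drop (n mod length xs) xs) = filter P xs"
    by (metis append_take_drop_id filter_append)
  finally show ?thesis by blast
qed

lemma filter_rotate1_ex:
  "\<exists>k. filter P (rotate k xs) = rotate1 (filter P xs)"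
proof (cases "filter P xs")
  case Nil
  then show ?thesis by (intro exI[of _ 0]) simp
next
  case (Cons y ys)
  then obtain us vs where *: "xs = us @ y # vs" "\<forall>u\<in>set us. \<not> P u" "P y" "ys = filter P vs"
    by (auto simp: filter_eq_Cons_iff)
  then have "xs = (us @ [y]) @ vs" by simp
  then have "rotate (length (us @ [y])) xs = vs @ us @ [y]"
    by (simp only: rotate_append)
  moreover have "filter P us = []" using * by simp
  ultimately show ?thesis
    using Cons * by (intro exI[of _ "length (us @ [y])"]) simp
qed

lemma filter_rotate_surj:
  "\<exists>k. filter P (rotate k xs) = rotate n (filter P xs)"
proof (induction n)
  case 0
  then show ?case by (intro exI[of _ 0]) simp
next
  case (Suc n)
  then obtain k where k: "filter P (rotate k xs) = rotate n (filter P xs)" by blast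
  obtain j where "filter P (rotate j (rotate k xs)) = rotate1 (filter P (rotate k xs))"
    using filter_rotate1_ex by blast
  then have "filter P (rotate (j + k) xs) = rotate (Suc n) (filter P xs)"
    using k by (simp add: rotate_rotate)
  then show ?case by blast
qed

lemma has_pattern_iff_rotate:
  fixes G :: "('a, 'b) pre_digraph" and u v :: 'a
  assumes perm: "permutation (face_succ arev \<rho>)" and F: "F = orbit (face_succ arev \<rho>) x"
  defines "qs \<equiv> filter (\<lambda>w. w \<in> {u, v})
    (map (\<lambda>k. tail G ((face_succ arev \<rho> ^^ k) x)) [0..<card F])"
  shows "has_pattern G arev \<rho> u v F ps \<longleftrightarrow> (\<exists>n. ps = rotate n qs)"
proof -
  let ?f = "face_succ arev \<rho>"
  have rot: "map (\<lambda>k. tail G ((?f ^^ k) ((?f ^^ m) x))) [0..<card F] =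
      rotate m (map (\<lambda>k. tail G ((?f ^^ k) x)) [0..<card F])" for m
    using arg_cong[where f = "map (tail G)",
        OF funpow_list_rotate[OF funpow_card_orbit(1)[OF perm], of m x]]
    unfolding F by (simp add: rotate_map comp_def)
  have "has_pattern G arev \<rho> u v F ps \<longleftrightarrow>
      (\<exists>m. filter (\<lambda>w. w \<in> {u, v})
        (map (\<lambda>k. tail G ((?f ^^ k) ((?f ^^ m) x))) [0..<card F]) = ps)"
    unfolding has_pattern_def using orbit_altdef_permutation[OF perm, of x] F by auto
  also have "\<dots> \<longleftrightarrow> (\<exists>n. ps = rotate n qs)"
    unfolding rot qs_def using filter_rotate_ex filter_rotate_surj by metis
  finally show ?thesis .
qed

text \<open>
  A word with two letters \<open>u\<close> and two letters \<open>v\<close> is one of six, four of which are the rotations of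
  \<open>uuvv\<close> and two of which are the rotations of \<open>uvuv\<close>.
\<close>
lemma pattern_word_cases:
  assumes "set qs \<subseteq> {u, v}" "u \<noteq> v"
    and "length (filter ((=) u) qs) = 2" "length (filter ((=) v) qs) = 2"
  shows "(\<exists>n. [u, u, v, v] = rotate n qs) \<longleftrightarrow> \<not> (\<exists>n. [u, v, u, v] = rotate n qs)"
proof -
  have "length (filter ((=) u) xs) + length (filter ((=) v) xs) = length xs"
    if "set xs \<subseteq> {u, v}" for xs
    using that assms(2) by (induct xs) auto
  from this[OF assms(1)] have len: "length qs = Suc (Suc (Suc (Suc 0)))" using assms(3,4) by simp
  then obtain a b c d where qs: "qs = [a, b, c, d]"
    unfolding length_Suc_conv by auto
  have rot: "rotate 0 qs = [a, b, c, d]" "rotate 1 qs = [b, c, d, a]"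
      "rotate 2 qs = [c, d, a, b]" "rotate 3 qs = [d, a, b, c]"
    by (simp_all add: qs rotate_drop_take)
  have ex: "(\<exists>n. ps = rotate n qs) \<longleftrightarrow>
      ps = [a, b, c, d] \<or> ps = [b, c, d, a] \<or> ps = [c, d, a, b] \<or> ps = [d, a, b, c]" for ps
  proof
    assume "\<exists>n. ps = rotate n qs"
    then obtain n where "ps = rotate n qs" by blast
    then have "ps = rotate (n mod 4) qs" using rotate_conv_mod[of n qs] by (simp add: qs)
    moreover have "n mod 4 = 0 \<or> n mod 4 = 1 \<or> n mod 4 = 2 \<or> n mod 4 = 3" by presburger
    ultimately show "ps = [a, b, c, d] \<or> ps = [b, c, d, a] \<or> ps = [c, d, a, b] \<or> ps = [d, a, b, c]"
      using rot by metis
  next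
    assume "ps = [a, b, c, d] \<or> ps = [b, c, d, a] \<or> ps = [c, d, a, b] \<or> ps = [d, a, b, c]"
    then show "\<exists>n. ps = rotate n qs" using rot by metis
  qed
  have "a = u \<or> a = v" "b = u \<or> b = v" "c = u \<or> c = v" "d = u \<or> d = v"
    using assms(1) by (auto simp: qs)
  then show ?thesis
    unfolding ex using assms(2-4) unfolding qs by (elim disjE) simp_all
qed

lemma has_pattern_cases:
  fixes G :: "('a, 'b) pre_digraph"
  assumes perm: "permutation (face_succ arev \<rho>)" and F: "F \<in> orbit (face_succ arev \<rho>) ` arcs G"
    and arcs: "F \<subseteq> arcs G" and uv: "u \<noteq> v"
    and card: "card (F \<inter> out_arcs G u) = 2" "card (F \<inter> out_arcs G v) = 2"
  shows "has_pattern G arev \<rho> u v F [u, u, v, v] \<longleftrightarrow> \<not> has_pattern G arev \<rho> u v F [u, v, u, v]"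
proof -
  obtain x where x: "F = orbit (face_succ arev \<rho>) x" using F by blast
  let ?L = "map (\<lambda>k. (face_succ arev \<rho> ^^ k) x) [0..<card F]"
  let ?qs = "filter (\<lambda>w. w \<in> {u, v}) (map (\<lambda>k. tail G ((face_succ arev \<rho> ^^ k) x)) [0..<card F])"
  have L: "distinct ?L" "set ?L = F"
    unfolding x by (rule funpow_card_orbit[OF perm])+
  have count: "length (filter ((=) w) (filter P (map t xs))) = length (filter (\<lambda>a. t a = w) xs)"
    if "P w" for P w and t :: "'b \<Rightarrow> 'a" and xs
    using that by (induct xs) auto
  have len: "length (filter ((=) w) ?qs) = card (F \<inter> out_arcs G w)" if "w \<in> {u, v}" for w
  proof -
    have "map (\<lambda>k. tail G ((face_succ arev \<rho> ^^ k) x)) [0..<card F] = map (tail G) ?L"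
      unfolding map_map comp_def ..
    then have "length (filter ((=) w) ?qs) = length (filter (\<lambda>a. tail G a = w) ?L)"
      using count[where P = "\<lambda>w. w \<in> {u, v}", OF that, of "tail G" ?L] by argo
    also have "\<dots> = card (set (filter (\<lambda>a. tail G a = w) ?L))"
      by (rule distinct_card[symmetric]) (rule distinct_filter[OF L(1)])
    also have "set (filter (\<lambda>a. tail G a = w) ?L) = F \<inter> out_arcs G w"
      unfolding set_filter L using arcs by auto
    finally show ?thesis .
  qed
  have "set ?qs \<subseteq> {u, v}" by auto
  then show ?thesis
    unfolding has_pattern_iff_rotate[OF perm x]
    using uv len[of u] len[of v] card by (intro pattern_word_cases) simp_all
qed

section \<open>Corner pairs on a common face\<close>

text \<open>
  A corner is represented by the arc that leaves it, as in \<^const>\<open>fb_at\<close>.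
\<close>
definition common_corners ::
    "('a, 'b) pre_digraph \<Rightarrow> ('b \<Rightarrow> 'b) \<Rightarrow> ('b \<Rightarrow> 'b) \<Rightarrow> 'a \<Rightarrow> 'a \<Rightarrow> ('b \<times> 'b) set" where
  "common_corners G arev \<rho> u v =
     {(a, c) \<in> out_arcs G u \<times> out_arcs G v.
       orbit (face_succ arev \<rho>) a = orbit (face_succ arev \<rho>) c}"

lemma type_at_2_valent:
  assumes perm: "permutation (face_succ arev \<rho>)" and w: "out_arcs G w = {a, b}" "a \<noteq> b"
  shows "fb_at G arev \<rho> w = {orbit (face_succ arev \<rho>) a, orbit (face_succ arev \<rho>) b}"
    and "type_d G arev \<rho> w \<longleftrightarrow> orbit (face_succ arev \<rho>) a \<noteq> orbit (face_succ arev \<rho>) b"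
    and "type_s G arev \<rho> w \<longleftrightarrow> orbit (face_succ arev \<rho>) a = orbit (face_succ arev \<rho>) b"
    and "orbit (face_succ arev \<rho>) a = orbit (face_succ arev \<rho>) b \<Longrightarrow>
      card (orbit (face_succ arev \<rho>) a \<inter> out_arcs G w) = 2"
proof -
  let ?O = "orbit (face_succ arev \<rho>)"
  note self = permutation_self_in_orbit[OF perm]
  note eq = in_orbit_iff_orbit_eq[OF perm]
  have ab: "a \<in> arcs G" "b \<in> arcs G" using w by auto
  then have fb: "fb_walks G arev \<rho> = ?O ` arcs G" by (auto simp: fb_walks_def)
  show at: "fb_at G arev \<rho> w = {?O a, ?O b}"
    unfolding fb_at_def fb w using ab self by (auto simp: eq)
  show "type_d G arev \<rho> w \<longleftrightarrow> ?O a \<noteq> ?O b"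
    unfolding type_d_def at by (cases "?O a = ?O b") simp_all
  have two: "?O a \<inter> out_arcs G w = {a, b}" if "?O a = ?O b"
    using self[of a] self[of b] that unfolding w by auto
  then show "?O a = ?O b \<Longrightarrow> card (?O a \<inter> out_arcs G w) = 2" using w by simp
  show "type_s G arev \<rho> w \<longleftrightarrow> ?O a = ?O b"
  proof
    assume "type_s G arev \<rho> w"
    then obtain x where x: "card (?O x \<inter> {a, b}) = 2"
      unfolding type_s_def fb w by auto
    have "?O x \<inter> {a, b} = {a, b}"
      using x w(2) by (intro card_subset_eq) simp_all
    then have "a \<in> ?O x" "b \<in> ?O x" by auto
    then show "?O a = ?O b" by (simp add: eq)
  next
    assume *: "?O a = ?O b"
    then show "type_s G arev \<rho> w"
      unfolding type_s_def fb using two[OF *] w ab by (intro bexI[of _ "?O a"]) auto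
  qed
qed

text \<open>
  Every embedding has exactly one of the ten types, so a quantity that depends on the type only is a
  combination of the indicators of the types.  This form can be summed directly over all embeddings
  in a surface.  The two equations have as coefficients the constant and the linear coefficients of
  the entries of the vector \<open>B\<close>.
\<close>
lemma card_common_corners:
  assumes fin: "fin_digraph G" and bi: "bidirected_digraph G arev" and uv: "u \<noteq> v"
    and deg: "out_degree G u = 2" "out_degree G v = 2"
    and \<rho>: "\<rho> \<in> rotation_systems G"
  defines "du \<equiv> type_d G arev \<rho> u" and "dv \<equiv> type_d G arev \<rho> v"
    and "su \<equiv> type_s G arev \<rho> u" and "sv \<equiv> type_s G arev \<rho> v"
    and "N \<equiv> card (shared_fb G arev \<rho> u v)"
    and "p1 \<equiv> \<exists>F \<in> shared_fb G arev \<rho> u v. has_pattern G arev \<rho> u v F [u, u, v, v]"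
    and "p2 \<equiv> \<exists>F \<in> shared_fb G arev \<rho> u v. has_pattern G arev \<rho> u v F [u, v, u, v]"
  shows "int (card (common_corners G arev \<rho> u v)) =
      of_bool (du \<and> dv \<and> N = 1) + 2 * of_bool (du \<and> dv \<and> N = 2)
      + 2 * of_bool (du \<and> sv \<and> N = 1) + 2 * of_bool (su \<and> dv \<and> N = 1)
      + 4 * of_bool (su \<and> sv \<and> p1) + 4 * of_bool (su \<and> sv \<and> p2)" (is ?same)
    and "4 - int (card (common_corners G arev \<rho> u v)) =
      4 * of_bool (du \<and> dv \<and> N = 0) + 3 * of_bool (du \<and> dv \<and> N = 1)
      + 2 * of_bool (du \<and> dv \<and> N = 2)
      + 4 * of_bool (du \<and> sv \<and> N = 0) + 2 * of_bool (du \<and> sv \<and> N = 1)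
      + 4 * of_bool (su \<and> dv \<and> N = 0) + 2 * of_bool (su \<and> dv \<and> N = 1)
      + 4 * of_bool (su \<and> sv \<and> N = 0)" (is ?diff)
proof -
  interpret fin_digraph G by fact
  have permutes: "face_succ arev \<rho> permutes arcs G" by (rule face_succ_permutes[OF bi \<rho>])
  have perm: "permutation (face_succ arev \<rho>)"
    by (rule permutes_imp_permutation[OF finite_arcs permutes])
  obtain a1 a2 where a: "out_arcs G u = {a1, a2}" "a1 \<noteq> a2"
    using deg(1) unfolding out_degree_def card_2_iff by blast
  obtain c1 c2 where c: "out_arcs G v = {c1, c2}" "c1 \<noteq> c2"
    using deg(2) unfolding out_degree_def card_2_iff by blast
  define fw where "fw = orbit (face_succ arev \<rho>)"
  define A B C D where "A = fw a1" and "B = fw a2" and "C = fw c1" and "D = fw c2"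
  note u = type_at_2_valent[OF perm a, folded fw_def, folded A_def B_def]
  note v = type_at_2_valent[OF perm c, folded fw_def, folded C_def D_def]
  have shared: "shared_fb G arev \<rho> u v = {A, B} \<inter> {C, D}"
    by (simp add: shared_fb_def u v)
  have types: "du = (A \<noteq> B)" "su = (A = B)" "dv = (C \<noteq> D)" "sv = (C = D)"
    by (simp_all add: du_def su_def dv_def sv_def u v)
  have N: "int N = of_bool (A = C \<or> A = D) + of_bool (A \<noteq> B \<and> (B = C \<or> B = D))"
  proof -
    have "{A, B} \<inter> {C, D} =
        (if A = C \<or> A = D then {A} else {}) \<union> (if B = C \<or> B = D then {B} else {})"
      by auto
    then show ?thesis
      unfolding N_def shared
      by (cases "A = C \<or> A = D"; cases "B = C \<or> B = D"; cases "A = B"; simp)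
  qed
  have pattern: "has_pattern G arev \<rho> u v A [u, u, v, v] \<longleftrightarrow>
      \<not> has_pattern G arev \<rho> u v A [u, v, u, v]" if "A = B" "C = D" "A = C"
  proof (rule has_pattern_cases[OF perm _ _ uv])
    have "a1 \<in> arcs G" using a by auto
    then show "A \<in> orbit (face_succ arev \<rho>) ` arcs G" "A \<subseteq> arcs G"
      unfolding A_def fw_def using permutes_orbit_subset[OF permutes] by auto
    show "card (A \<inter> out_arcs G u) = 2" "card (A \<inter> out_arcs G v) = 2"
      using u(4) v(4) that by auto
  qed
  have p: "su \<and> sv \<and> p1 \<longleftrightarrow> A = B \<and> C = D \<and> A = C \<and> has_pattern G arev \<rho> u v A [u, u, v, v]"
    "su \<and> sv \<and> p2 \<longleftrightarrow> A = B \<and> C = D \<and> A = C \<and> has_pattern G arev \<rho> u v A [u, v, u, v]"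
    unfolding types p1_def p2_def shared
    by (cases "A = B"; cases "C = D"; cases "A = C"; simp)+
  have common: "common_corners G arev \<rho> u v =
      (out_arcs G u \<times> out_arcs G v) \<inter> {p. fw (fst p) = fw (snd p)}"
    by (auto simp: common_corners_def fw_def)
  have "int (card (common_corners G arev \<rho> u v)) =
      (\<Sum>p\<in>out_arcs G u \<times> out_arcs G v. of_bool (fw (fst p) = fw (snd p)))"
    using a c common by (simp add: sum_of_bool_eq)
  also have "\<dots> = (\<Sum>x\<in>{a1, a2}. \<Sum>y\<in>{c1, c2}. of_bool (fw x = fw y))"
    unfolding a c sum.cartesian_product case_prod_beta ..
  also have "\<dots> = of_bool (A = C) + of_bool (A = D) + of_bool (B = C) + of_bool (B = D)"
    using a(2) c(2) by (simp add: A_def B_def C_def D_def del: sum_of_bool_eq)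
  finally have count: "int (card (common_corners G arev \<rho> u v)) =
      of_bool (A = C) + of_bool (A = D) + of_bool (B = C) + of_bool (B = D)" .
  have N': "N = 0 \<longleftrightarrow> int N = 0" "N = 1 \<longleftrightarrow> int N = 1" "N = 2 \<longleftrightarrow> int N = 2" by auto
  show ?same ?diff
    unfolding count p unfolding N' N types using pattern
    by (cases "A = B"; cases "C = D"; cases "A = C"; cases "A = D"; cases "B = C"; cases "B = D"; simp)+
qed

section \<open>The genus polynomial\<close>

text \<open>
  The extensions of genus \<open>i\<close> come from embeddings of genus \<open>i\<close> with both corners on a common fb-walk,
  and from embeddings of genus \<open>i - 1\<close> with corners on different ones.  For \<open>i = 0\<close> the latter would
  have Euler characteristic \<open>4\<close>, which the Euler bound excludes.
\<close>
lemma card_embeddings_self_bar: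
  fixes G :: "('a, 'b) pre_digraph"
  assumes fin: "fin_digraph G" and bi: "bidirected_digraph G arev" and conn: "connected G"
    and uv: "u \<in> verts G" "v \<in> verts G" "u \<noteq> v"
    and deg: "out_degree G u = 2" "out_degree G v = 2"
  shows "int (card (embeddings (self_bar G u v) (self_bar_rev arev) i)) =
    (\<Sum>\<rho>\<in>embeddings G arev i. int (card (common_corners G arev \<rho> u v))) +
    (case i of 0 \<Rightarrow> 0 | Suc j \<Rightarrow>
      (\<Sum>\<rho>\<in>embeddings G arev j. 4 - int (card (common_corners G arev \<rho> u v))))"
proof -
  interpret fin_digraph G by fact
  define pairs where "pairs = out_arcs G u \<times> out_arcs G v"
  let ?same = "\<lambda>\<rho>. common_corners G arev \<rho> u v"
  let ?h = "\<lambda>(\<rho>, a, c). bar_rotation \<rho> a c"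
  let ?E = "\<lambda>k. {\<rho> \<in> rotation_systems G. euler_char G arev \<rho> = k}"
  define S where "S = Sigma (?E (2 - 2 * int i)) ?same \<union>
    Sigma (?E (4 - 2 * int i)) (\<lambda>\<rho>. pairs - ?same \<rho>)"
  have ne: "out_arcs G u \<noteq> {}" "out_arcs G v \<noteq> {}"
    using deg by (auto simp: out_degree_def)
  have finR: "finite (rotation_systems G)"
    by (rule finite_subset[OF _ finite_permutations[OF finite_arcs]])
       (auto simp: rotation_systems_def)
  have fin_pairs: "finite pairs" "card pairs = 4"
    using deg by (auto simp: pairs_def out_degree_def card_cartesian_product)
  have sub: "?same \<rho> \<subseteq> pairs" for \<rho> by (auto simp: common_corners_def pairs_def)
  have bij: "bij_betw ?h (rotation_systems G \<times> pairs) (rotation_systems (self_bar G u v))"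
    unfolding pairs_def by (rule bij_betw_bar_rotation[OF finite_arcs uv ne])
  have \<chi>: "euler_char (self_bar G u v) (self_bar_rev arev) (?h (\<rho>, p)) =
      euler_char G arev \<rho> - (if p \<in> ?same \<rho> then 0 else 2)"
    if "\<rho> \<in> rotation_systems G" "p \<in> pairs" for \<rho> p
    using that uv by (auto simp: pairs_def common_corners_def
        intro!: euler_char_bar_rotation[OF finite_arcs bi, THEN trans])
  have S: "S = {x \<in> rotation_systems G \<times> pairs.
      euler_char (self_bar G u v) (self_bar_rev arev) (?h x) = 2 - 2 * int i}"
  proof (rule Set.set_eqI)
    fix x :: "('b \<Rightarrow> 'b) \<times> 'b \<times> 'b"
    obtain \<rho> p where x: "x = (\<rho>, p)" by (cases x)
    show "x \<in> S \<longleftrightarrow> x \<in> {x \<in> rotation_systems G \<times> pairs.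
      euler_char (self_bar G u v) (self_bar_rev arev) (?h x) = 2 - 2 * int i}"
      unfolding x S_def using \<chi>[of \<rho> p] sub[of \<rho>]
      by (cases "p \<in> ?same \<rho>") auto
  qed
  have "embeddings (self_bar G u v) (self_bar_rev arev) i = ?h ` S"
    unfolding S embeddings_def bij_betw_imp_surj_on[OF bij, symmetric] by blast
  moreover have "inj_on ?h S"
    using bij_betw_imp_inj_on[OF bij] by (rule inj_on_subset) (auto simp: S)
  ultimately have "card (embeddings (self_bar G u v) (self_bar_rev arev) i) = card S"
    by (simp add: card_image)
  also have "\<dots> = card (Sigma (?E (2 - 2 * int i)) ?same)
      + card (Sigma (?E (4 - 2 * int i)) (\<lambda>\<rho>. pairs - ?same \<rho>))"
    unfolding S_def using finR fin_pairs finite_subset[OF sub]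
    by (intro card_Un_disjoint finite_SigmaI) auto
  also have "\<dots> = (\<Sum>\<rho>\<in>?E (2 - 2 * int i). card (?same \<rho>))
      + (\<Sum>\<rho>\<in>?E (4 - 2 * int i). card (pairs - ?same \<rho>))"
    using finR fin_pairs finite_subset[OF sub] by (simp add: card_SigmaI)
  finally have "int (card (embeddings (self_bar G u v) (self_bar_rev arev) i)) =
      (\<Sum>\<rho>\<in>?E (2 - 2 * int i). int (card (?same \<rho>)))
      + (\<Sum>\<rho>\<in>?E (4 - 2 * int i). int (card (pairs - ?same \<rho>)))"
    by simp
  moreover have "int (card (pairs - ?same \<rho>)) = 4 - int (card (?same \<rho>))" for \<rho>
    using card_Diff_subset[OF finite_subset[OF sub fin_pairs(1)] sub, of \<rho>]
      card_mono[OF fin_pairs(1) sub, of \<rho>] fin_pairs(2) by (simp add: of_nat_diff)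
  moreover have "?E (4 - 2 * int i) = (case i of 0 \<Rightarrow> {} | Suc j \<Rightarrow> embeddings G arev j)"
  proof (cases i)
    case 0
    have "arcs G \<noteq> {}" using ne by auto
    from euler_char_le_2[OF fin bi conn _ this] have "euler_char G arev \<rho> \<noteq> 4"
      if "\<rho> \<in> rotation_systems G" for \<rho>
      using that by fastforce
    then show ?thesis using 0 by auto
  next
    case (Suc j)
    then have "4 - 2 * int i = 2 - 2 * int j" by simp
    then show ?thesis by (simp add: Suc embeddings_def)
  qed
  moreover have "?E (2 - 2 * int i) = embeddings G arev i"
    by (simp add: embeddings_def)
  ultimately have "int (card (embeddings (self_bar G u v) (self_bar_rev arev) i)) =
      (\<Sum>\<rho>\<in>embeddings G arev i. int (card (?same \<rho>)))
      + (\<Sum>\<rho>\<in>(case i of 0 \<Rightarrow> {} | Suc j \<Rightarrow> embeddings G arev j). 4 - int (card (?same \<rho>)))"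
    by (simp only:)
  then show ?thesis by (cases i) simp_all
qed

lemma coeff_mult_linear:
  fixes p :: "'a :: comm_ring_1 poly"
  shows "coeff (p * [:a, b:]) i = a * coeff p i + (case i of 0 \<Rightarrow> 0 | Suc j \<Rightarrow> b * coeff p j)"
  by (simp add: coeff_pCons mult.commute[of p] split: nat.split)

theorem theorem4p1:
  fixes G :: "('a, 'b) pre_digraph" and arev :: "'b \<Rightarrow> 'b" and u v :: 'a
  assumes "fin_digraph G" and "bidirected_digraph G arev" and "connected G"
    and "u \<in> verts G" and "v \<in> verts G" and "u \<noteq> v"
    and "out_degree G u = 2" and "out_degree G v = 2"
    and "(u, v) \<notin> arcs_ends G"
  shows "genus_poly (self_bar G u v) (self_bar_rev arev) =
           pgd_vector G arev u v \<bullet>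
           vec_of_list
             [[:0, 4:], [:1, 3:], [:2, 2:], [:0, 4:], [:2, 2:],
              [:0, 4:], [:2, 2:], [:0, 4:], [:4:], [:4:]]"
proof (rule poly_eqI)
  fix i
  interpret fin_digraph G by fact
  have fin: "finite (embeddings G arev j)" for j
    by (rule finite_subset[OF _ finite_permutations[OF finite_arcs]])
       (auto simp: embeddings_def rotation_systems_def)
  have gen: "coeff (genpoly c) j = (\<Sum>\<rho>\<in>embeddings G arev j. of_bool (P \<rho>))"
    if "c = (\<lambda>j. card {\<rho> \<in> embeddings G arev j. P \<rho>})" for c P j
    unfolding that coeff_genpoly[OF finite_arcs] using fin by (simp add: sum_of_bool_eq Int_def)
  note gens = gen[OF ext, OF dd0_def] gen[OF ext, OF dd'_def] gen[OF ext, OF dd''_def]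
    gen[OF ext, OF ds0_def] gen[OF ext, OF ds'_def] gen[OF ext, OF sd0_def] gen[OF ext, OF sd'_def]
    gen[OF ext, OF ss0_def] gen[OF ext, OF ss1_def] gen[OF ext, OF ss2_def]
  have RS: "\<rho> \<in> rotation_systems G" if "\<rho> \<in> embeddings G arev j" for \<rho> j
    using that by (simp add: embeddings_def)
  note weights = card_common_corners[OF assms(1,2,6,7,8)]
  have same: "(\<Sum>\<rho>\<in>embeddings G arev j. int (card (common_corners G arev \<rho> u v))) =
      coeff (genpoly (dd' G arev u v)) j + 2 * coeff (genpoly (dd'' G arev u v)) j
      + 2 * coeff (genpoly (ds' G arev u v)) j + 2 * coeff (genpoly (sd' G arev u v)) j
      + 4 * coeff (genpoly (ss1 G arev u v)) j + 4 * coeff (genpoly (ss2 G arev u v)) j" for j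
    unfolding gens sum_distrib_left sum.distrib[symmetric]
    by (rule sum.cong[OF refl weights(1)[OF RS]])
  have diff: "(\<Sum>\<rho>\<in>embeddings G arev j. 4 - int (card (common_corners G arev \<rho> u v))) =
      4 * coeff (genpoly (dd0 G arev u v)) j + 3 * coeff (genpoly (dd' G arev u v)) j
      + 2 * coeff (genpoly (dd'' G arev u v)) j
      + 4 * coeff (genpoly (ds0 G arev u v)) j + 2 * coeff (genpoly (ds' G arev u v)) j
      + 4 * coeff (genpoly (sd0 G arev u v)) j + 2 * coeff (genpoly (sd' G arev u v)) j
      + 4 * coeff (genpoly (ss0 G arev u v)) j" for j
    unfolding gens sum_distrib_left sum.distrib[symmetric]
    by (rule sum.cong[OF refl weights(2)[OF RS]])
  \<comment> \<open>The constant entries of \<open>B\<close> are written with a linear coefficient \<open>0\<close>, so that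
    \<open>coeff_mult_linear\<close> applies to all entries alike.\<close>
  have dot: "pgd_vector G arev u v \<bullet> vec_of_list
             [[:0, 4:], [:1, 3:], [:2, 2:], [:0, 4:], [:2, 2:],
              [:0, 4:], [:2, 2:], [:0, 4:], [:4, 0:], [:4, 0:]] =
      genpoly (dd0 G arev u v) * [:0, 4:] + genpoly (dd' G arev u v) * [:1, 3:]
      + genpoly (dd'' G arev u v) * [:2, 2:] + genpoly (ds0 G arev u v) * [:0, 4:]
      + genpoly (ds' G arev u v) * [:2, 2:] + genpoly (sd0 G arev u v) * [:0, 4:]
      + genpoly (sd' G arev u v) * [:2, 2:] + genpoly (ss0 G arev u v) * [:0, 4:]
      + genpoly (ss1 G arev u v) * [:4, 0:] + genpoly (ss2 G arev u v) * [:4, 0:]"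
    unfolding pgd_vector_def vec_of_list_Cons scalar_prod_vCons by simp
  have "coeff (genus_poly (self_bar G u v) (self_bar_rev arev)) i =
      int (card (embeddings (self_bar G u v) (self_bar_rev arev) i))"
    by (rule coeff_genus_poly) simp
  also have "\<dots> = coeff (pgd_vector G arev u v \<bullet> vec_of_list
             [[:0, 4:], [:1, 3:], [:2, 2:], [:0, 4:], [:2, 2:],
              [:0, 4:], [:2, 2:], [:0, 4:], [:4, 0:], [:4, 0:]]) i"
    unfolding dot coeff_add coeff_mult_linear card_embeddings_self_bar[OF assms(1-8)]
    by (cases i) (simp_all add: same diff)
  finally show "coeff (genus_poly (self_bar G u v) (self_bar_rev arev)) i =
      coeff (pgd_vector G arev u v \<bullet> vec_of_list
             [[:0, 4:], [:1, 3:], [:2, 2:], [:0, 4:], [:2, 2:],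
              [:0, 4:], [:2, 2:], [:0, 4:], [:4:], [:4:]]) i"
    by simp
qed

end
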